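(* Let $M$, $K$, $N$, $W$ be the finite element mass, stiffness, convection and (local projection) stabilization matrices described in the context, for a diffusion coefficient $\epsilon>0$ and a divergence-free wind $\mathbf{w}$, and let $L=\epsilon K+N+W$. Assume that $\mathbf{w}\cdot\mathbf{n}=0$ on $\partial\Omega_N$ (no restriction if $\partial\Omega_N=\emptyset$; the heat equation case $\mathbf{w}=\mathbf{0}$, $\epsilon=1$, $N=W=0$ is allowed with any Dirichlet, Neumann or mixed boundary conditions). Let $\beta>0$, $t_f>0$, $n_t\ge 1$ an integer, $\tau=t_f/n_t$, and let the $n_tn_x\times n_tn_x$ matrices $A_D,C_D,T_1,T_2,\Lambda_{21},\widehat{M}$ be as in the context. Set $$A=T_1A_DT_1^\top,\qquad B_D=\Lambda_{21}T_2^{-1},$$ $$S_{\mathrm{int}}=C_D+B_DA_D^{-1}B_D^\top,\qquad \widetilde{S}_{\mathrm{int}}=(\Lambda_{21}+\widehat{M})\,A^{-1}\,(\Lambda_{21}+\widehat{M})^\top .$$ Then every eigenvalue of $\widetilde{S}_{\mathrm{int}}^{-1}S_{\mathrm{int}}$ lies in the interval $\left[\tfrac12,1\right]$.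
   Context: Spatial discretization. $\Omega\subset\mathbb{R}^d$, $d\in\{1,2,3\}$, is a bounded (Lipschitz) domain with boundary $\partial\Omega=\partial\Omega_D\cup\partial\Omega_N$, $\partial\Omega_D\cap\partial\Omega_N=\emptyset$, outer unit normal $\mathbf{n}$, and $\mathbf{w}$ is a time-independent vector field on $\overline\Omega$, regular enough for Green's theorem, with $\nabla\cdot\mathbf{w}=0$. Let $\{\phi_i\}_{i=1}^{n_x}$ be linearly independent continuous, piecewise polynomial finite element basis functions on $\Omega$ vanishing on $\partial\Omega_D$. For $i,j=1,\dots,n_x$ define the real $n_x\times n_x$ matrices $$k_{ij}=\int_\Omega\nabla\phi_i\cdot\nabla\phi_j\,d\Omega,\quad n_{ij}=\int_\Omega(\mathbf{w}\cdot\nabla\phi_j)\phi_i\,d\Omega,\quad m_{ij}=\int_\Omega\phi_i\phi_j\,d\Omega,$$ $K=(k_{ij})$, $N=(n_{ij})$, $M=(m_{ij})$. The stabilization matrix $W=(w_{ij})$ is defined as follows: $\Omega$ is partitioned into patches $\mathtt{P}_k$ (each a union of finite elements), $\pi_h(v)|_{\mathtt{P}_k}=\frac{1}{|\mathtt{P}_k|}\int_{\mathtt{P}_k}v$ is the patchwise mean, and $$w_{ij}=\sum_k\delta_k\int_{\mathtt{P}_k}[\mathbf{w}\cdot\nabla\phi_i-\pi_h(\mathbf{w}\cdot\nabla\phi_i)]\,[\mathbf{w}\cdot\nabla\phi_j-\pi_h(\mathbf{w}\cdot\nabla\phi_j)]\,d\Omega,$$ where $\delta_k=\frac{h_k}{2\|\mathbf{w}_k\|}\left(1-\frac1{P_k}\right)$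 if $P_k>1$ and $\delta_k=0$ if $P_k\le1$, with $P_k=\frac{\|\mathbf{w}_k\|h_k}{2\epsilon}$, $\|\mathbf{w}_k\|$ the Euclidean norm of $\mathbf{w}$ at the centroid of $\mathtt{P}_k$, and $h_k>0$ a measure of the length of $\mathtt{P}_k$ in the direction of the wind. Time discretization (Crank--Nicolson). Put $L^+=\frac{\tau}{2}L+M$, $L^-=\frac{\tau}{2}L-M$. Let $I_m$ be the $m\times m$ identity and let $E\in\mathbb{R}^{n_t\times n_t}$ have ones on the first subdiagonal and zeros elsewhere; $\otimes$ is the Kronecker product. The $n_t n_x\times n_t n_x$ matrices are $$A_D=\tfrac{\tau}{2}\,I_{n_t}\otimes M,\qquad C_D=\tfrac{\tau}{2\beta}\,I_{n_t}\otimes M,\qquad T_2=(I_{n_t}+E)\otimes I_{n_x},\qquad T_1=T_2^\top,$$ $$\Lambda_{21}=I_{n_t}\otimes L^+ + E\otimes L^-,\qquad \widehat{M}=\tfrac{\tau}{2\sqrt\beta}\,(I_{n_t}+E)\otimes M .$$ (So $\Lambda_{21}$ is block lower bidiagonal with diagonal blocks $L^+$ and subdiagonal blocks $L^-$; $\widehat M$ is block lower bidiagonal with all nonzero blocks equal to $\frac{\tau}{2\sqrt\beta}M$.) *)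

theory Defs
  imports
    "HOL-Analysis.Analysis"
    "Jordan_Normal_Form.Char_Poly"
    "Jordan_Normal_Form.Gauss_Jordan_Elimination"
begin

no_notation scalar_prod (infix "\<bullet>" 70)

definition grad :: "('a::euclidean_space \<Rightarrow> real) \<Rightarrow> 'a \<Rightarrow> 'a" where
  "grad f x = (THE D. GDERIV f x :> D)"

definition divergence :: "('a::euclidean_space \<Rightarrow> 'a) \<Rightarrow> 'a \<Rightarrow> real" where
  "divergence w x = (\<Sum>b\<in>Basis. frechet_derivative w (at x) b \<bullet> b)"

text \<open>Near each boundary point, in some Cartesian coordinate system with last axis \<open>e\<close>, the set
  is the strict subgraph of a Lipschitz function \<open>g\<close> of the remaining coordinates; these are the
  coordinates of the projection \<open>y - (y \<bullet> e) *\<^sub>R e\<close> of \<open>y\<close>.\<close>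

definition bounded_lipschitz_domain :: "'a::euclidean_space set \<Rightarrow> bool" where
  "bounded_lipschitz_domain \<Omega> \<longleftrightarrow>
     open \<Omega> \<and> connected \<Omega> \<and> bounded \<Omega> \<and> \<Omega> \<noteq> {} \<and>
     (\<forall>x\<in>frontier \<Omega>. \<exists>e g L r. norm e = 1 \<and> L-lipschitz_on UNIV g \<and> r > 0 \<and>
        (\<forall>y\<in>ball x r. y \<in> \<Omega> \<longleftrightarrow> y \<bullet> e < g (y - (y \<bullet> e) *\<^sub>R e)))"

text \<open>The boundary is tangent at \<open>x\<close> to the hyperplane orthogonal to \<open>n\<close>, with \<open>\<Omega>\<close> on the side
  of \<open>-n\<close>. At most one \<open>n\<close> has this property; at an edge or a corner there is none, and
  there the normal is set to \<open>0\<close>. For a Lipschitz domain the exceptional points form a null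
  set for the surface measure.\<close>

definition is_outer_unit_normal :: "'a::euclidean_space set \<Rightarrow> 'a \<Rightarrow> 'a \<Rightarrow> bool" where
  "is_outer_unit_normal \<Omega> x n \<longleftrightarrow> norm n = 1 \<and>
     (\<forall>e>0. \<forall>\<^sub>F y in at x.
        (y \<in> \<Omega> \<longrightarrow> (y - x) \<bullet> n < e * norm (y - x)) \<and>
        (y \<notin> \<Omega> \<longrightarrow> (y - x) \<bullet> n > - e * norm (y - x)))"

definition outer_normal :: "'a::euclidean_space set \<Rightarrow> 'a \<Rightarrow> 'a" where
  "outer_normal \<Omega> x =
     (if \<exists>n. is_outer_unit_normal \<Omega> x n then THE n. is_outer_unit_normal \<Omega> x n else 0)"

text \<open>Hausdorff measure of integer dimension \<open>s\<close>, normalised by the volume of the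
  \<open>s\<close>-dimensional unit ball so as to agree with surface area; counting measure for \<open>s = 0\<close>,
  because \<open>0 ^ 0 = 1\<close>.\<close>

definition hausdorff_premeasure :: "nat \<Rightarrow> real \<Rightarrow> 'a::euclidean_space set \<Rightarrow> ennreal" where
  "hausdorff_premeasure s \<delta> A =
     (INF U\<in>{U :: nat \<Rightarrow> 'a set. A \<subseteq> (\<Union>i. U i) \<and> (\<forall>i. bounded (U i) \<and> diameter (U i) \<le> \<delta>)}.
        \<Sum>i. if U i = {} then 0 else ennreal (unit_ball_vol (real s) * (diameter (U i) / 2) ^ s))"

definition hausdorff_measure :: "nat \<Rightarrow> 'a::euclidean_space measure" where
  "hausdorff_measure s =
     measure_of UNIV (sets borel) (\<lambda>A. SUP \<delta>\<in>{0<..}. hausdorff_premeasure s \<delta> A)"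

abbreviation surface_measure :: "'a::euclidean_space measure" where
  "surface_measure \<equiv> hausdorff_measure (DIM('a) - 1)"

text \<open>The elements are closed and may be curved. The usual requirement that their boundaries be
  Lipschitz is relaxed to null boundaries, and no face-to-face condition is imposed.\<close>

definition fe_mesh :: "'a::euclidean_space set \<Rightarrow> 'a set set \<Rightarrow> bool" where
  "fe_mesh \<Omega> \<T> \<longleftrightarrow>
     finite \<T> \<and> \<Union>\<T> = closure \<Omega> \<and>
     (\<forall>T\<in>\<T>. compact T \<and> interior T \<noteq> {} \<and> negligible (frontier T)) \<and>
     pairwise (\<lambda>T T'. interior T \<inter> interior T' = {}) \<T>"

definition cont_piecewise_poly ::
  "'a::euclidean_space set \<Rightarrow> 'a set set \<Rightarrow> ('a \<Rightarrow> real) \<Rightarrow> bool" where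
  "cont_piecewise_poly \<Omega> \<T> v \<longleftrightarrow>
     continuous_on (closure \<Omega>) v \<and>
     (\<forall>T\<in>\<T>. \<exists>p. real_polynomial_function p \<and> (\<forall>x\<in>T. v x = p x))"

definition lin_indep_on :: "'a set \<Rightarrow> nat \<Rightarrow> (nat \<Rightarrow> 'a \<Rightarrow> real) \<Rightarrow> bool" where
  "lin_indep_on \<Omega> n \<phi> \<longleftrightarrow>
     (\<forall>c. (\<forall>x\<in>\<Omega>. (\<Sum>i<n. c i * \<phi> i x) = 0) \<longrightarrow> (\<forall>i<n. c i = 0))"

text \<open>The regularity of the wind is expressed by the formula it is needed for: Green's formula
  \<open>\<integral>\<^sub>\<Omega> w \<bullet> \<nabla>v + v \<nabla>\<bullet>w = \<integral>\<^sub>\<partial>\<^sub>\<Omega> v w \<bullet> n\<close> for the finite element functions \<open>v\<close>. It holds,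
  for instance, if \<open>\<Omega>\<close> is a bounded Lipschitz domain and \<open>w\<close> is continuously differentiable
  up to the boundary.\<close>

definition greens_formula ::
  "'a::euclidean_space set \<Rightarrow> 'a set set \<Rightarrow> ('a \<Rightarrow> 'a) \<Rightarrow> bool" where
  "greens_formula \<Omega> \<T> w \<longleftrightarrow>
     (\<forall>v. cont_piecewise_poly \<Omega> \<T> v \<longrightarrow>
        (LINT x:\<Omega>|lebesgue. w x \<bullet> grad v x + v x * divergence w x) =
        (LINT x:frontier \<Omega>|surface_measure. v x * (w x \<bullet> outer_normal \<Omega> x)))"

text \<open>Basis functions are numbered from \<open>0\<close>. Gradients of finite element functions are
  meaningful in the interiors of the elements only, hence almost everywhere.\<close>

definition mass_mat :: "'a::euclidean_space set \<Rightarrow> nat \<Rightarrow> (nat \<Rightarrow> 'a \<Rightarrow> real) \<Rightarrow> real mat" where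
  "mass_mat \<Omega> n \<phi> = Matrix.mat n n (\<lambda>(i, j). LINT x:\<Omega>|lebesgue. \<phi> i x * \<phi> j x)"

definition stiffness_mat :: "'a::euclidean_space set \<Rightarrow> nat \<Rightarrow> (nat \<Rightarrow> 'a \<Rightarrow> real) \<Rightarrow> real mat" where
  "stiffness_mat \<Omega> n \<phi> =
     Matrix.mat n n (\<lambda>(i, j). LINT x:\<Omega>|lebesgue. grad (\<phi> i) x \<bullet> grad (\<phi> j) x)"

definition convection_mat ::
  "'a::euclidean_space set \<Rightarrow> ('a \<Rightarrow> 'a) \<Rightarrow> nat \<Rightarrow> (nat \<Rightarrow> 'a \<Rightarrow> real) \<Rightarrow> real mat" where
  "convection_mat \<Omega> w n \<phi> =
     Matrix.mat n n (\<lambda>(i, j). LINT x:\<Omega>|lebesgue. (w x \<bullet> grad (\<phi> j) x) * \<phi> i x)"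

definition patch_mean :: "'a::euclidean_space set \<Rightarrow> ('a \<Rightarrow> real) \<Rightarrow> real" where
  "patch_mean P v = 1 / measure lebesgue P * (LINT x:P|lebesgue. v x)"

definition centroid :: "'a::euclidean_space set \<Rightarrow> 'a" where
  "centroid P = (1 / measure lebesgue P) *\<^sub>R (LINT x:P|lebesgue. x)"

definition peclet :: "real \<Rightarrow> ('a::euclidean_space \<Rightarrow> 'a) \<Rightarrow> real \<Rightarrow> 'a set \<Rightarrow> real" where
  "peclet \<epsilon> w h P = norm (w (centroid P)) * h / (2 * \<epsilon>)"

definition stab_param :: "real \<Rightarrow> ('a::euclidean_space \<Rightarrow> 'a) \<Rightarrow> real \<Rightarrow> 'a set \<Rightarrow> real" where
  "stab_param \<epsilon> w h P =
     (if peclet \<epsilon> w h P > 1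
      then h / (2 * norm (w (centroid P))) * (1 - 1 / peclet \<epsilon> w h P)
      else 0)"

definition fluctuation ::
  "('a::euclidean_space \<Rightarrow> 'a) \<Rightarrow> 'a set \<Rightarrow> ('a \<Rightarrow> real) \<Rightarrow> 'a \<Rightarrow> real" where
  "fluctuation w P v x = w x \<bullet> grad v x - patch_mean P (\<lambda>y. w y \<bullet> grad v y)"

text \<open>A patch is given by the set \<open>p\<close> of its elements and occupies the region \<open>\<Union>p\<close>; \<open>h p\<close> is
  its length in the direction of the wind.\<close>

definition stab_mat ::
  "real \<Rightarrow> ('a::euclidean_space \<Rightarrow> 'a) \<Rightarrow> 'a set set set \<Rightarrow> ('a set set \<Rightarrow> real) \<Rightarrow>
   nat \<Rightarrow> (nat \<Rightarrow> 'a \<Rightarrow> real) \<Rightarrow> real mat" where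
  "stab_mat \<epsilon> w \<P> h n \<phi> =
     Matrix.mat n n (\<lambda>(i, j). \<Sum>p\<in>\<P>. stab_param \<epsilon> w (h p) (\<Union>p) *
       (LINT x:\<Union>p|lebesgue. fluctuation w (\<Union>p) (\<phi> i) x * fluctuation w (\<Union>p) (\<phi> j) x))"

definition kron :: "'a::semiring_0 mat \<Rightarrow> 'a mat \<Rightarrow> 'a mat" (infixl "\<otimes>\<^sub>K" 73) where
  "A \<otimes>\<^sub>K B = Matrix.mat (dim_row A * dim_row B) (dim_col A * dim_col B)
     (\<lambda>(i, j). A $$ (i div dim_row B, j div dim_col B) * B $$ (i mod dim_row B, j mod dim_col B))"

definition subdiag_mat :: "nat \<Rightarrow> real mat" where
  "subdiag_mat n = Matrix.mat n n (\<lambda>(i, j). if i = Suc j then 1 else 0)"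

text \<open>Meaningful for invertible matrices only.\<close>

abbreviation mat_inv :: "'a::field mat \<Rightarrow> 'a mat" where
  "mat_inv A \<equiv> the (mat_inverse A)"

end

theory Submission
  imports Defs
begin

text \<open>Put \<open>c = 1 / \<surd>\<beta>\<close>. Since \<open>Mhat = c A\<^sub>D T\<^sub>2\<close> and \<open>C\<^sub>D = c\<^sup>2 A\<^sub>D\<close>, the two Schur complements satisfy
  \<open>St = (B + c A\<^sub>D) A\<^sub>D\<^sup>-\<^sup>1 (B + c A\<^sub>D)\<^sup>T = S + c (B + B\<^sup>T)\<close> and
  \<open>2 S - St = (B - c A\<^sub>D) A\<^sub>D\<^sup>-\<^sup>1 (B - c A\<^sub>D)\<^sup>T\<close>, where \<open>B = B\<^sub>D\<close>. The second identity gives the bound \<open>1/2\<close>, and the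
  bound \<open>1\<close> amounts to \<open>B + B\<^sup>T\<close> being positive semidefinite, that is, to
  \<open>(T\<^sub>2 u) \<bullet> (\<Lambda>\<^sub>21 u) \<ge> 0\<close>. With \<open>v\<^sub>k = u\<^sub>k + u\<^sub>k\<^sub>-\<^sub>1\<close>, this number is a sum of the terms
  \<open>\<tau>/2 v\<^sub>k \<bullet> L v\<^sub>k + u\<^sub>k \<bullet> M u\<^sub>k - u\<^sub>k\<^sub>-\<^sub>1 \<bullet> M u\<^sub>k\<^sub>-\<^sub>1\<close>, of which the last two telescope. Finally \<open>L\<close> is
  accretive: \<open>K\<close> and \<open>W\<close> are Gram matrices, and \<open>N\<close> is skew-symmetric by Green's formula.\<close>

unbundle no vec_syntax

notation scalar_prod (infix "\<bullet>\<^sub>v" 70)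

section \<open>Generalized eigenvalues and the Schur complements\<close>

lemma smult_mat_mult_vec:
  assumes "A \<in> carrier_mat nr nc" "v \<in> carrier_vec nc"
  shows "(c \<cdot>\<^sub>m A) *\<^sub>v v = c \<cdot>\<^sub>v (A *\<^sub>v v :: 'a::comm_ring vec)"
  using assms by (auto intro!: eq_vecI simp: scalar_prod_def sum_distrib_left mult.assoc)

lemma transpose_smult_mat: "transpose_mat (c \<cdot>\<^sub>m A) = c \<cdot>\<^sub>m transpose_mat A"
  by (auto intro!: eq_matI)

text \<open>A right inverse of a square matrix is also a left inverse, so \<open>A\<close> is a unit
  of the matrix ring and \<open>mat_inverse\<close> succeeds; whatever it returns agrees with
  \<open>B\<close> by uniqueness of inverses.\<close>

lemma mat_inv_eqI:
  fixes A :: "'a::field mat"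
  assumes A: "A \<in> carrier_mat n n" and B: "B \<in> carrier_mat n n" and AB: "A * B = 1\<^sub>m n"
  shows "mat_inv A = B"
proof -
  have BA: "B * A = 1\<^sub>m n" by (rule mat_mult_left_right_inverse[OF A B AB])
  have "A \<in> Units (ring_mat TYPE('a) n ())"
    using A B AB BA unfolding Units_def by (auto simp: ring_mat_simps)
  then obtain C where C: "mat_inverse A = Some C" using mat_inverse(1)[OF A, of "()"] by (cases "mat_inverse A") auto
  have CA: "A * C = 1\<^sub>m n" "C * A = 1\<^sub>m n" "C \<in> carrier_mat n n" using mat_inverse(2)[OF A C] by auto
  have "C = C * (A * B)" using AB CA by simp
  also have "\<dots> = C * A * B" using assoc_mult_mat[OF CA(3) A B] by simp
  also have "\<dots> = B" using CA(2) B by simp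
  finally show ?thesis using C by simp
qed

lemma mat_inv_det:
  fixes A :: "'a::field mat"
  assumes A: "A \<in> carrier_mat n n" and d: "det A \<noteq> 0"
  shows "mat_inv A \<in> carrier_mat n n" "A * mat_inv A = 1\<^sub>m n" "mat_inv A * A = 1\<^sub>m n"
    "invertible_mat A"
proof -
  obtain B where B: "B \<in> carrier_mat n n" "A * B = 1\<^sub>m n" "B * A = 1\<^sub>m n"
    using det_non_zero_imp_unit[OF A d, of "()"] unfolding Units_def by (auto simp: ring_mat_simps)
  have [simp]: "mat_inv A = B" by (rule mat_inv_eqI[OF A B(1,2)])
  show "mat_inv A \<in> carrier_mat n n" "A * mat_inv A = 1\<^sub>m n" "mat_inv A * A = 1\<^sub>m n"
    using B by auto
  show "invertible_mat A" using A B unfolding invertible_mat_def inverts_mat_def by auto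
qed

text \<open>A nonzero kernel vector of a singular \<open>P\<close> would annihilate the quadratic
  form.\<close>

lemma pos_def_det:
  fixes P :: "real mat"
  assumes P: "P \<in> carrier_mat n n"
    and pos: "\<And>x. x \<in> carrier_vec n \<Longrightarrow> x \<noteq> 0\<^sub>v n \<Longrightarrow> x \<bullet>\<^sub>v (P *\<^sub>v x) > 0"
  shows "det P \<noteq> 0"
proof
  assume "det P = 0"
  then obtain x where x: "x \<in> carrier_vec n" "x \<noteq> 0\<^sub>v n" "P *\<^sub>v x = 0\<^sub>v n"
    using det_0_iff_vec_prod_zero[OF P] by auto
  then show False using pos[OF x(1,2)] by simp
qed

lemma sym_scalar_prod:
  fixes P :: "real mat"
  assumes "P \<in> carrier_mat n n" "transpose_mat P = P" "x \<in> carrier_vec n" "y \<in> carrier_vec n"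
  shows "x \<bullet>\<^sub>v (P *\<^sub>v y) = y \<bullet>\<^sub>v (P *\<^sub>v x)"
  using transpose_vec_mult_scalar[of P n n y x] assms
  by (metis comm_scalar_prod mult_mat_vec_carrier)

section \<open>Eigenvalues of a symmetric definite pencil\<close>

lemma map_Re_Im_mult_mat_vec:
  assumes "P \<in> carrier_mat n n" "v \<in> carrier_vec n"
  shows "map_vec Re (map_mat complex_of_real P *\<^sub>v v) = P *\<^sub>v map_vec Re v"
    and "map_vec Im (map_mat complex_of_real P *\<^sub>v v) = P *\<^sub>v map_vec Im v"
  using assms by (auto simp: scalar_prod_def intro!: eq_vecI)

text \<open>Testing the equation with the conjugate of \<open>v\<close> gives
  \<open>q = \<mu> * p\<close> for the Hermitian forms \<open>p > 0\<close> and \<open>q\<close> of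
  \<open>P\<close> and \<open>Q\<close>. Both are real by symmetry, so \<mu> is real and equals a
  Rayleigh quotient. The argument is carried out with the real and imaginary parts of
  \<open>v\<close> and \<mu>, because the form bounds are given for real vectors.\<close>

lemma generalized_eigenvalue_bounds:
  fixes P Q :: "real mat" and v :: "complex vec"
  assumes P: "P \<in> carrier_mat n n" "transpose_mat P = P"
    and Q: "Q \<in> carrier_mat n n" "transpose_mat Q = Q"
    and pos: "\<And>x. x \<in> carrier_vec n \<Longrightarrow> x \<noteq> 0\<^sub>v n \<Longrightarrow> x \<bullet>\<^sub>v (P *\<^sub>v x) > 0"
    and lower: "\<And>x. x \<in> carrier_vec n \<Longrightarrow> l * (x \<bullet>\<^sub>v (P *\<^sub>v x)) \<le> x \<bullet>\<^sub>v (Q *\<^sub>v x)"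
    and upper: "\<And>x. x \<in> carrier_vec n \<Longrightarrow> x \<bullet>\<^sub>v (Q *\<^sub>v x) \<le> u * (x \<bullet>\<^sub>v (P *\<^sub>v x))"
    and v: "v \<in> carrier_vec n" "v \<noteq> 0\<^sub>v n"
    and eq: "map_mat complex_of_real Q *\<^sub>v v = \<mu> \<cdot>\<^sub>v (map_mat complex_of_real P *\<^sub>v v)"
  shows "\<mu> \<in> complex_of_real ` {l..u}"
proof -
  define a b where "a = map_vec Re v" and "b = map_vec Im v"
  define r s where "r = Re \<mu>" and "s = Im \<mu>"
  have ab: "a \<in> carrier_vec n" "b \<in> carrier_vec n" using v by (auto simp: a_def b_def)
  note PQ[simp] = mult_mat_vec_carrier[OF P(1) ab(1)] mult_mat_vec_carrier[OF P(1) ab(2)]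
    mult_mat_vec_carrier[OF Q(1) ab(1)] mult_mat_vec_carrier[OF Q(1) ab(2)]
  have Re_smult: "map_vec Re (\<mu> \<cdot>\<^sub>v z) = r \<cdot>\<^sub>v map_vec Re z - s \<cdot>\<^sub>v map_vec Im z"
    and Im_smult: "map_vec Im (\<mu> \<cdot>\<^sub>v z) = r \<cdot>\<^sub>v map_vec Im z + s \<cdot>\<^sub>v map_vec Re z" for z
    by (auto simp: r_def s_def intro!: eq_vecI)
  have Qa: "Q *\<^sub>v a = r \<cdot>\<^sub>v (P *\<^sub>v a) - s \<cdot>\<^sub>v (P *\<^sub>v b)"
    using arg_cong[OF eq, of "map_vec Re"]
    by (simp add: Re_smult map_Re_Im_mult_mat_vec[OF P(1) v(1)] map_Re_Im_mult_mat_vec[OF Q(1) v(1)] a_def b_def)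
  have Qb: "Q *\<^sub>v b = r \<cdot>\<^sub>v (P *\<^sub>v b) + s \<cdot>\<^sub>v (P *\<^sub>v a)"
    using arg_cong[OF eq, of "map_vec Im"]
    by (simp add: Im_smult map_Re_Im_mult_mat_vec[OF P(1) v(1)] map_Re_Im_mult_mat_vec[OF Q(1) v(1)] a_def b_def)
  \<comment> \<open>For real symmetric matrices the Hermitian form at \<open>a + i b\<close> is the
    sum of the real forms at \<open>a\<close> and at \<open>b\<close>; the mixed terms
    cancel.\<close>
  define p where "p = a \<bullet>\<^sub>v (P *\<^sub>v a) + b \<bullet>\<^sub>v (P *\<^sub>v b)"
  define q where "q = a \<bullet>\<^sub>v (Q *\<^sub>v a) + b \<bullet>\<^sub>v (Q *\<^sub>v b)"
  have Pab: "a \<bullet>\<^sub>v (P *\<^sub>v b) = b \<bullet>\<^sub>v (P *\<^sub>v a)" by (rule sym_scalar_prod[OF P ab])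
  have Qab: "a \<bullet>\<^sub>v (Q *\<^sub>v b) = b \<bullet>\<^sub>v (Q *\<^sub>v a)" by (rule sym_scalar_prod[OF Q ab])
  have aQa: "a \<bullet>\<^sub>v (Q *\<^sub>v a) = r * (a \<bullet>\<^sub>v (P *\<^sub>v a)) - s * (a \<bullet>\<^sub>v (P *\<^sub>v b))"
    unfolding Qa using ab by (simp add: scalar_prod_minus_distrib[of _ n])
  have bQa: "b \<bullet>\<^sub>v (Q *\<^sub>v a) = r * (b \<bullet>\<^sub>v (P *\<^sub>v a)) - s * (b \<bullet>\<^sub>v (P *\<^sub>v b))"
    unfolding Qa using ab by (simp add: scalar_prod_minus_distrib[of _ n])
  have aQb: "a \<bullet>\<^sub>v (Q *\<^sub>v b) = r * (a \<bullet>\<^sub>v (P *\<^sub>v b)) + s * (a \<bullet>\<^sub>v (P *\<^sub>v a))"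
    unfolding Qb using ab by (simp add: scalar_prod_add_distrib[of _ n])
  have bQb: "b \<bullet>\<^sub>v (Q *\<^sub>v b) = r * (b \<bullet>\<^sub>v (P *\<^sub>v b)) + s * (b \<bullet>\<^sub>v (P *\<^sub>v a))"
    unfolding Qb using ab by (simp add: scalar_prod_add_distrib[of _ n])
  have nonneg: "x \<bullet>\<^sub>v (P *\<^sub>v x) \<ge> 0" if "x \<in> carrier_vec n" for x
    using pos[OF that] P(1) that by (cases "x = 0\<^sub>v n") (auto intro: less_imp_le)
  have "a \<noteq> 0\<^sub>v n \<or> b \<noteq> 0\<^sub>v n"
  proof (rule ccontr)
    assume "\<not> (a \<noteq> 0\<^sub>v n \<or> b \<noteq> 0\<^sub>v n)"
    then have ab0: "a = 0\<^sub>v n" "b = 0\<^sub>v n" by auto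
    have "v $ i = 0" if "i < n" for i
      using arg_cong[OF ab0(1), of "\<lambda>x. x $ i"] arg_cong[OF ab0(2), of "\<lambda>x. x $ i"] v(1) that
      by (auto simp: a_def b_def complex_eq_iff)
    then show False using v by (auto intro!: eq_vecI)
  qed
  then have p: "p > 0"
    unfolding p_def using pos[OF ab(1)] pos[OF ab(2)] nonneg[OF ab(1)] nonneg[OF ab(2)] by linarith
  have "q = r * p" unfolding q_def p_def aQa bQb Pab by (simp add: algebra_simps)
  \<comment> \<open>By symmetry of \<open>Q\<close> the expressions for the two mixed products
    \<open>aQb\<close> and \<open>bQa\<close> coincide. By symmetry of \<open>P\<close> the terms
    with \<open>r\<close> cancel, which leaves \<open>s\<close> times both diagonal terms.\<close>
  moreover have "s * p = 0"
    using aQb bQa Qab Pab unfolding p_def by (simp add: algebra_simps)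
  moreover have "l * p \<le> q" "q \<le> u * p"
    using lower[OF ab(1)] lower[OF ab(2)] upper[OF ab(1)] upper[OF ab(2)]
    unfolding p_def q_def by (auto simp: algebra_simps)
  ultimately have "s = 0" "l \<le> r" "r \<le> u" using p by auto
  then show ?thesis by (intro image_eqI[of _ _ r]) (auto simp: r_def s_def complex_eq_iff)
qed

text \<open>Multiplying the eigenvalue equation by \<open>P\<close> turns it into the pencil
  equation \<open>Q v = \<mu> P v\<close>. The preconditioned matrix itself is in general not
  symmetric, whereas the pencil is.\<close>

lemma eigenvalue_preconditioned_bounds:
  fixes P Q :: "real mat"
  assumes P: "P \<in> carrier_mat n n" "transpose_mat P = P"
    and Q: "Q \<in> carrier_mat n n" "transpose_mat Q = Q"
    and pos: "\<And>x. x \<in> carrier_vec n \<Longrightarrow> x \<noteq> 0\<^sub>v n \<Longrightarrow> x \<bullet>\<^sub>v (P *\<^sub>v x) > 0"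
    and lower: "\<And>x. x \<in> carrier_vec n \<Longrightarrow> l * (x \<bullet>\<^sub>v (P *\<^sub>v x)) \<le> x \<bullet>\<^sub>v (Q *\<^sub>v x)"
    and upper: "\<And>x. x \<in> carrier_vec n \<Longrightarrow> x \<bullet>\<^sub>v (Q *\<^sub>v x) \<le> u * (x \<bullet>\<^sub>v (P *\<^sub>v x))"
    and ev: "eigenvalue (map_mat complex_of_real (mat_inv P * Q)) \<mu>"
  shows "\<mu> \<in> complex_of_real ` {l..u}"
proof -
  let ?c = "map_mat complex_of_real"
  have d: "det P \<noteq> 0" by (rule pos_def_det[OF P(1) pos])
  note I = mat_inv_det[OF P(1) d]
  obtain v where v: "v \<in> carrier_vec n" "v \<noteq> 0\<^sub>v n" "?c (mat_inv P * Q) *\<^sub>v v = \<mu> \<cdot>\<^sub>v v"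
    using ev I(1) Q(1) unfolding eigenvalue_def eigenvector_def by auto
  have "?c Q = ?c (P * (mat_inv P * Q))"
    using I(1,2) P(1) Q(1) by (simp flip: assoc_mult_mat[of P n n "mat_inv P" n Q n])
  also have "\<dots> = ?c P * ?c (mat_inv P * Q)"
    by (rule of_real_hom.mat_hom_mult[OF P(1)]) (use I Q in auto)
  finally have "?c Q *\<^sub>v v = ?c P *\<^sub>v (?c (mat_inv P * Q) *\<^sub>v v)"
    using v P Q I by (simp add: assoc_mult_mat_vec[of _ n n _ n])
  also have "\<dots> = \<mu> \<cdot>\<^sub>v (?c P *\<^sub>v v)"
    unfolding v(3) using v P by (simp add: mult_mat_vec[of _ n n])
  finally show ?thesis
    by (intro generalized_eigenvalue_bounds[OF P Q pos lower upper v(1,2)])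
qed

section \<open>Congruences and the abstract Schur complement estimate\<close>

lemma congruence_scalar_prod:
  fixes B R :: "real mat"
  assumes "B \<in> carrier_mat n n" "R \<in> carrier_mat n n" "x \<in> carrier_vec n" "y \<in> carrier_vec n"
  shows "x \<bullet>\<^sub>v ((B * R * transpose_mat B) *\<^sub>v y) =
    (transpose_mat B *\<^sub>v x) \<bullet>\<^sub>v (R *\<^sub>v (transpose_mat B *\<^sub>v y))"
proof -
  have "(B * R * transpose_mat B) *\<^sub>v y = B *\<^sub>v (R *\<^sub>v (transpose_mat B *\<^sub>v y))"
    using assms by (simp add: assoc_mult_mat_vec[of _ n n _ n])
  then show ?thesis
    using transpose_vec_mult_scalar[of B n n "R *\<^sub>v (transpose_mat B *\<^sub>v y)" x] assms by simp
qed

lemma transpose_congruence: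
  fixes B R :: "real mat"
  assumes "B \<in> carrier_mat n n" "R \<in> carrier_mat n n" "transpose_mat R = R"
  shows "transpose_mat (B * R * transpose_mat B) = B * R * transpose_mat B"
  using assms by (simp add: transpose_mult[of _ n n _ n] assoc_mult_mat[of _ n n _ n _ n])

lemma transpose_mat_inv:
  fixes P :: "real mat"
  assumes P: "P \<in> carrier_mat n n" "det P \<noteq> 0"
  shows "transpose_mat (mat_inv P) = mat_inv (transpose_mat P)"
proof -
  note I = mat_inv_det[OF P]
  have "transpose_mat P * transpose_mat (mat_inv P) = 1\<^sub>m n"
    using I P by (metis transpose_mult transpose_one)
  then show ?thesis using mat_inv_eqI[of "transpose_mat P" n] P I by (metis transpose_carrier_mat)
qed

text \<open>The estimate is separated here from time stepping and discretization: these enter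
  through the definiteness of \<open>D\<close> and the accretivity \<open>acc\<close>. The scaling
  of \<open>H\<close> is what makes \<open>\<Lambda> + H\<close> factor as
  \<open>(B + c D) T\<close>, so that the preconditioner becomes a congruence of the inverse of
  \<open>D\<close>, just like the second summand of \<open>S\<close>.\<close>

lemma preconditioned_schur_complement:
  fixes D C T \<Lambda> H A B S St :: "real mat"
  assumes D: "D \<in> carrier_mat n n" "transpose_mat D = D"
    and pos: "\<And>x. x \<in> carrier_vec n \<Longrightarrow> x \<noteq> 0\<^sub>v n \<Longrightarrow> x \<bullet>\<^sub>v (D *\<^sub>v x) > 0"
    and T: "T \<in> carrier_mat n n" "det T \<noteq> 0"
    and \<Lambda>: "\<Lambda> \<in> carrier_mat n n"
    and acc: "\<And>u. u \<in> carrier_vec n \<Longrightarrow> (T *\<^sub>v u) \<bullet>\<^sub>v (\<Lambda> *\<^sub>v u) \<ge> 0"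
    and c: "c > 0"
    and H: "H = c \<cdot>\<^sub>m (D * T)" and C: "C = c\<^sup>2 \<cdot>\<^sub>m D"
    and A: "A = transpose_mat T * D * T"
    and B: "B = \<Lambda> * mat_inv T"
    and S: "S = C + B * mat_inv D * transpose_mat B"
    and St: "St = (\<Lambda> + H) * mat_inv A * transpose_mat (\<Lambda> + H)"
  shows "invertible_mat T" "invertible_mat D" "invertible_mat A" "invertible_mat St"
    "eigenvalue (map_mat complex_of_real (mat_inv St * S)) \<mu> \<Longrightarrow> \<mu> \<in> complex_of_real ` {1/2..1}"
proof -
  have dD: "det D \<noteq> 0" by (rule pos_def_det[OF D(1) pos])
  note iD = mat_inv_det[OF D(1) dD]
  note iT = mat_inv_det[OF T]
  define R V where "R = mat_inv D" and "V = mat_inv T"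
  have R: "R \<in> carrier_mat n n" "D * R = 1\<^sub>m n" "R * D = 1\<^sub>m n" using iD by (auto simp: R_def)
  have V: "V \<in> carrier_mat n n" "T * V = 1\<^sub>m n" "V * T = 1\<^sub>m n" using iT by (auto simp: V_def)
  have Rsym: "transpose_mat R = R"
    unfolding R_def using transpose_mat_inv[OF D(1) dD] D(2) by simp
  have Ac: "A \<in> carrier_mat n n" using A D T by auto
  show "invertible_mat T" "invertible_mat D" using iT iD by auto
  have "det A \<noteq> 0"
    unfolding A using D T dD
    by (simp add: det_mult[of _ n] det_transpose[OF T(1)])
  then show "invertible_mat A" using mat_inv_det[OF Ac] by auto
  have TVt: "transpose_mat T * transpose_mat V = 1\<^sub>m n"
    using V T by (metis transpose_mult transpose_one)
  have invA: "mat_inv A = V * R * transpose_mat V"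
  proof (rule mat_inv_eqI[OF Ac])
    have "A * (V * R * transpose_mat V) = transpose_mat T * D * (T * V) * R * transpose_mat V"
      unfolding A using D(1) T(1) V(1) R(1) by (simp add: assoc_mult_mat[of _ n n _ n _ n])
    also have "\<dots> = transpose_mat T * (D * R) * transpose_mat V"
      unfolding V(2) using D(1) T(1) V(1) R(1) by (simp add: assoc_mult_mat[of _ n n _ n _ n])
    also have "\<dots> = 1\<^sub>m n" unfolding R(2) using TVt T(1) V(1) by simp
    finally show "A * (V * R * transpose_mat V) = 1\<^sub>m n" .
  qed (use V R in auto)
  have Bc: "B \<in> carrier_mat n n" using B \<Lambda> V by (auto simp: V_def)
  have Hc: "H \<in> carrier_mat n n" using H D T by auto
  define Q where "Q = B + c \<cdot>\<^sub>m D"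
  have Qc: "Q \<in> carrier_mat n n" using Bc D by (auto simp: Q_def)
  have HV: "H * V = c \<cdot>\<^sub>m D"
    unfolding H using D T V by (simp add: mult_smult_assoc_mat[of _ n n _ n] assoc_mult_mat[of _ n n _ n _ n])
  \<comment> \<open>The factor \<open>V\<close> of the inverse of \<open>A\<close> is absorbed into
    \<open>\<Lambda> + H\<close>; \<open>T\<close> thereby disappears from
    \<open>St\<close>.\<close>
  have QV: "(\<Lambda> + H) * V = Q"
    unfolding Q_def B V_def[symmetric] HV[symmetric] by (rule add_mult_distrib_mat[OF \<Lambda> Hc V(1)])
  have StQ: "St = Q * R * transpose_mat Q"
    unfolding St invA QV[symmetric] using \<Lambda> Hc V R
    by (simp add: transpose_mult[of _ n n _ n] assoc_mult_mat[of _ n n _ n _ n])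
  have SB: "S = c\<^sup>2 \<cdot>\<^sub>m D + B * R * transpose_mat B" unfolding S C R_def ..
  have Stc: "St \<in> carrier_mat n n" "transpose_mat St = St"
    unfolding StQ using transpose_congruence[OF Qc R(1) Rsym] Qc R by auto
  have Sc: "S \<in> carrier_mat n n" "transpose_mat S = S"
    unfolding SB using transpose_congruence[OF Bc R(1) Rsym] Bc R D
    by (auto simp: transpose_add[of _ n n] transpose_smult_mat)
  \<comment> \<open>The inverse inherits nonnegativity through the substitution
    \<open>y = D (R y)\<close>.\<close>
  have Rnonneg: "y \<bullet>\<^sub>v (R *\<^sub>v y) \<ge> 0" if y: "y \<in> carrier_vec n" for y
  proof -
    have Ry: "R *\<^sub>v y \<in> carrier_vec n" using R y by auto
    have "y = D *\<^sub>v (R *\<^sub>v y)" using R D y by (simp flip: assoc_mult_mat_vec[of D n n R n y])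
    then have "y \<bullet>\<^sub>v (R *\<^sub>v y) = (R *\<^sub>v y) \<bullet>\<^sub>v (D *\<^sub>v (R *\<^sub>v y))"
      using comm_scalar_prod[OF y Ry] by simp
    also have "\<dots> \<ge> 0" using pos[OF Ry] Ry D(1) by (cases "R *\<^sub>v y = 0\<^sub>v n") auto
    finally show ?thesis .
  qed
  \<comment> \<open>All forms are expressed by \<open>b = B^T x\<close> and \<open>d = D x\<close>.
    The third claim is the nonnegativity of \<open>2 S - St\<close> and the fourth that of the
    symmetric part of \<open>B\<close>.\<close>
  have forms: "x \<bullet>\<^sub>v (S *\<^sub>v x) = c\<^sup>2 * (x \<bullet>\<^sub>v (D *\<^sub>v x)) + b \<bullet>\<^sub>v (R *\<^sub>v b)"
      "x \<bullet>\<^sub>v (St *\<^sub>v x) = x \<bullet>\<^sub>v (S *\<^sub>v x) + 2 * c * (x \<bullet>\<^sub>v b)"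
      "2 * c * (x \<bullet>\<^sub>v b) \<le> x \<bullet>\<^sub>v (S *\<^sub>v x)" "x \<bullet>\<^sub>v b \<ge> 0"
    if x: "x \<in> carrier_vec n" and b: "b = transpose_mat B *\<^sub>v x" for x b
  proof -
    have bc: "b \<in> carrier_vec n" using x Bc b by auto
    define d where "d = D *\<^sub>v x"
    have d: "d \<in> carrier_vec n" using x D by (auto simp: d_def)
    have Rd: "R *\<^sub>v d = x" using R D x by (simp add: d_def flip: assoc_mult_mat_vec[of R n n D n x])
    have Rb: "R *\<^sub>v b \<in> carrier_vec n" using R bc by auto
    have dRb: "d \<bullet>\<^sub>v (R *\<^sub>v b) = x \<bullet>\<^sub>v b"
      using sym_scalar_prod[OF R(1) Rsym d bc] comm_scalar_prod[OF x bc] Rd by simp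
    have bRd: "b \<bullet>\<^sub>v (R *\<^sub>v d) = x \<bullet>\<^sub>v b" using comm_scalar_prod[OF x bc] Rd by simp
    have dRd: "d \<bullet>\<^sub>v (R *\<^sub>v d) = x \<bullet>\<^sub>v d" using comm_scalar_prod[OF x d] Rd by simp
    \<comment> \<open>The parameter \<open>t\<close> serves twice: \<open>t = c\<close> evaluates
      \<open>St\<close>, and \<open>t = -c\<close> yields the perfect square behind the lower
      bound.\<close>
    have quad: "(b + t \<cdot>\<^sub>v d) \<bullet>\<^sub>v (R *\<^sub>v (b + t \<cdot>\<^sub>v d)) =
        b \<bullet>\<^sub>v (R *\<^sub>v b) + 2 * t * (x \<bullet>\<^sub>v b) + t\<^sup>2 * (x \<bullet>\<^sub>v d)" for t
    proof -
      have "R *\<^sub>v (b + t \<cdot>\<^sub>v d) = R *\<^sub>v b + t \<cdot>\<^sub>v (R *\<^sub>v d)"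
        using R bc d by (simp add: mult_add_distrib_mat_vec[of _ n n] mult_mat_vec[of _ n n])
      moreover have "R *\<^sub>v d \<in> carrier_vec n" using R d by auto
      ultimately show ?thesis
        using bc d Rb by (simp add: scalar_prod_add_distrib[of _ n] add_scalar_prod_distrib[of _ n]
            dRb bRd dRd power2_eq_square algebra_simps)
    qed
    have tQ: "transpose_mat Q *\<^sub>v x = b + c \<cdot>\<^sub>v d"
      unfolding Q_def using Bc D x
      by (simp add: transpose_add[of _ n n] add_mult_distrib_mat_vec[of _ n n] b d_def smult_mat_mult_vec[of _ n n] transpose_smult_mat)
    show 1: "x \<bullet>\<^sub>v (S *\<^sub>v x) = c\<^sup>2 * (x \<bullet>\<^sub>v (D *\<^sub>v x)) + b \<bullet>\<^sub>v (R *\<^sub>v b)"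
    proof -
      define z where "z = B * R * transpose_mat B *\<^sub>v x"
      have z: "z \<in> carrier_vec n"
        unfolding z_def using Bc R(1) x
        by (intro mult_mat_vec_carrier[of _ n n] mult_carrier_mat[of _ n n]) auto
      have "S *\<^sub>v x = c\<^sup>2 \<cdot>\<^sub>v d + z"
        unfolding SB d_def z_def using Bc R(1) D(1) x
        by (subst add_mult_distrib_mat_vec[of _ n n])
          (auto simp: smult_mat_mult_vec[of _ n n] intro!: mult_carrier_mat[of _ n n])
      moreover have "x \<bullet>\<^sub>v z = b \<bullet>\<^sub>v (R *\<^sub>v b)"
        unfolding z_def b by (rule congruence_scalar_prod[OF Bc R(1) x x])
      ultimately show ?thesis
        using x d z by (simp add: scalar_prod_add_distrib[of _ n] flip: d_def)
    qed
    show "x \<bullet>\<^sub>v (St *\<^sub>v x) = x \<bullet>\<^sub>v (S *\<^sub>v x) + 2 * c * (x \<bullet>\<^sub>v b)"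
      unfolding StQ congruence_scalar_prod[OF Qc R(1) x x] tQ quad 1 d_def[symmetric] by simp
    have "b + (-c) \<cdot>\<^sub>v d \<in> carrier_vec n" using bc d by auto
    from Rnonneg[OF this] show "2 * c * (x \<bullet>\<^sub>v b) \<le> x \<bullet>\<^sub>v (S *\<^sub>v x)"
      unfolding quad 1 d_def[symmetric] by simp
    \<comment> \<open>Accretivity is applied at \<open>u = V x\<close>, for which
      \<open>T u = x\<close> and \<open>\<Lambda> u = B x\<close>.\<close>
    have Vx: "V *\<^sub>v x \<in> carrier_vec n" using V x by auto
    have TV: "T *\<^sub>v (V *\<^sub>v x) = x" using V T x by (simp flip: assoc_mult_mat_vec[of T n n V n x])
    have "\<Lambda> *\<^sub>v (V *\<^sub>v x) = B *\<^sub>v x"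
      unfolding B V_def[symmetric] using \<Lambda> V x by (simp add: assoc_mult_mat_vec[of _ n n _ n])
    moreover have "x \<bullet>\<^sub>v b = x \<bullet>\<^sub>v (B *\<^sub>v x)"
      using transpose_vec_mult_scalar[OF Bc x x] comm_scalar_prod[OF x bc] b by simp
    ultimately show "x \<bullet>\<^sub>v b \<ge> 0" using acc[OF Vx] TV by simp
  qed
  have posS: "x \<bullet>\<^sub>v (S *\<^sub>v x) > 0" if "x \<in> carrier_vec n" "x \<noteq> 0\<^sub>v n" for x
    using forms(1)[OF that(1) refl] Rnonneg[of "transpose_mat B *\<^sub>v x"] pos[OF that] c Bc that
    by (simp add: add_pos_nonneg)
  have posSt: "x \<bullet>\<^sub>v (St *\<^sub>v x) > 0" if "x \<in> carrier_vec n" "x \<noteq> 0\<^sub>v n" for x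
    using forms(2,4)[OF that(1) refl] posS[OF that] c by (simp add: add_pos_nonneg)
  \<comment> \<open>Definiteness of \<open>St\<close> comes from that of \<open>S\<close>, since the
    difference \<open>2 c (x \<bullet> b)\<close> of their forms is nonnegative.\<close>
  have "det St \<noteq> 0" by (rule pos_def_det[OF Stc(1) posSt])
  then show "invertible_mat St" using mat_inv_det[OF Stc(1)] by auto
  show "\<mu> \<in> complex_of_real ` {1/2..1}"
    if "eigenvalue (map_mat complex_of_real (mat_inv St * S)) \<mu>"
  proof (rule eigenvalue_preconditioned_bounds[OF Stc Sc posSt _ _ that])
    fix x :: "real vec" assume x: "x \<in> carrier_vec n"
    show "1/2 * (x \<bullet>\<^sub>v (St *\<^sub>v x)) \<le> x \<bullet>\<^sub>v (S *\<^sub>v x)"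
      using forms(2,3)[OF x refl] by linarith
    show "x \<bullet>\<^sub>v (S *\<^sub>v x) \<le> 1 * (x \<bullet>\<^sub>v (St *\<^sub>v x))"
      using forms(2,4)[OF x refl] c by simp
  qed auto
qed

section \<open>Kronecker products and the Crank--Nicolson matrices\<close>

text \<open>The range splits into \<open>m\<close> consecutive segments of length \<open>n\<close>,
  on each of which the quotient is constant. This is the index pairing used by
  \<open>kron\<close>.\<close>

lemma sum_div_mod:
  fixes f :: "nat \<Rightarrow> nat \<Rightarrow> 'a::comm_monoid_add"
  shows "(\<Sum>k<m * n. f (k div n) (k mod n)) = (\<Sum>i<m. \<Sum>j<n. f i j)"
proof -
  have dm: "k div n = i" "k mod n = k - i * n" if "i * n \<le> k" "k < i * n + n" for i k
  proof -
    show "k div n = i" by (rule div_nat_eqI) (use that in \<open>auto simp: mult.commute\<close>)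
    then show "k mod n = k - i * n" using minus_div_mult_eq_mod[of k n] by simp
  qed
  have "(\<Sum>k\<in>{i * n..<i * n + n}. f (k div n) (k mod n)) = (\<Sum>j<n. f i j)" for i
    by (rule sum.reindex_bij_witness[of _ "\<lambda>j. i * n + j" "\<lambda>k. k - i * n"]) (auto simp: dm)
  then show ?thesis by (simp flip: sum.nat_group)
qed

text \<open>The time slices of an all-at-once vector: time is the outer Kronecker index, so the
  spatial unknowns of one time step are contiguous.\<close>

definition block :: "nat \<Rightarrow> 'a vec \<Rightarrow> nat \<Rightarrow> 'a vec" where
  "block n v k = Matrix.vec n (\<lambda>j. v $ (k * n + j))"

lemma block_carrier[simp]: "block n v k \<in> carrier_vec n"
  by (simp add: block_def)

lemma block_index_less: "k < m \<Longrightarrow> j < n \<Longrightarrow> k * n + j < m * (n::nat)"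
proof -
  assume "k < m" "j < n"
  moreover have "Suc k * n \<le> m * n" by (rule mult_le_mono1) (use \<open>k < m\<close> in simp)
  ultimately show ?thesis by simp
qed

lemma scalar_prod_block:
  assumes "x \<in> carrier_vec (m * n)" "y \<in> carrier_vec (m * n)"
  shows "x \<bullet>\<^sub>v y = (\<Sum>k<m. block n x k \<bullet>\<^sub>v block n y k)"
proof -
  have "x \<bullet>\<^sub>v y = (\<Sum>i<m * n. x $ (i div n * n + i mod n) * y $ (i div n * n + i mod n))"
    using assms by (simp add: scalar_prod_def atLeast0LessThan)
  also have "\<dots> = (\<Sum>k<m. \<Sum>j<n. x $ (k * n + j) * y $ (k * n + j))" by (rule sum_div_mod)
  also have "\<dots> = (\<Sum>k<m. block n x k \<bullet>\<^sub>v block n y k)"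
    by (simp add: scalar_prod_def block_def atLeast0LessThan)
  finally show ?thesis .
qed

lemma eq_vec_blockI:
  assumes "x \<in> carrier_vec (m * n)" "y \<in> carrier_vec (m * n)"
    and eq: "\<And>k. k < m \<Longrightarrow> block n x k = block n y k"
  shows "x = y"
proof (rule eq_vecI)
  fix i assume "i < dim_vec y"
  then have i: "i < m * n" using assms by simp
  then have "n > 0" by (cases n) auto
  moreover have "i div n < m" using i by (simp add: less_mult_imp_div_less)
  ultimately show "x $ i = y $ i"
    using arg_cong[OF eq[of "i div n"], of "\<lambda>v. v $ (i mod n)"] by (simp add: block_def)
qed (use assms in auto)

section \<open>Kronecker products acting on time slices\<close>

lemma kron_carrier[simp]:
  "A \<in> carrier_mat m m' \<Longrightarrow> B \<in> carrier_mat n n' \<Longrightarrow> A \<otimes>\<^sub>K B \<in> carrier_mat (m * n) (m' * n')"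
  by (auto simp: kron_def)

text \<open>The outer factor mixes the slices and the inner one acts within each. The statement is
  componentwise, so that only scalar sums occur.\<close>

lemma block_kron_mult_vec:
  fixes A B :: "'a::comm_ring_1 mat"
  assumes A: "A \<in> carrier_mat m m'" and B: "B \<in> carrier_mat n n'"
    and x: "x \<in> carrier_vec (m' * n')" and k: "k < m" and i: "i < n"
  shows "block n ((A \<otimes>\<^sub>K B) *\<^sub>v x) k $ i = (\<Sum>l<m'. A $$ (k, l) * (B *\<^sub>v block n' x l) $ i)"
proof -
  have ki: "k * n + i < m * n" using block_index_less[OF k i] .
  have dk: "(k * n + i) div n = k" "(k * n + i) mod n = i" using i by auto
  have "block n ((A \<otimes>\<^sub>K B) *\<^sub>v x) k $ i = (\<Sum>c<m' * n'. (A \<otimes>\<^sub>K B) $$ (k * n + i, c) * x $ c)"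
    using A B ki i x by (simp add: block_def scalar_prod_def atLeast0LessThan kron_def)
  also have "\<dots> = (\<Sum>c<m' * n'. A $$ (k, c div n') * B $$ (i, c mod n') * x $ (c div n' * n' + c mod n'))"
    using A B ki by (intro sum.cong refl) (simp add: kron_def dk i)
  also have "\<dots> = (\<Sum>l<m'. \<Sum>j<n'. A $$ (k, l) * B $$ (i, j) * x $ (l * n' + j))"
    by (rule sum_div_mod)
  also have "\<dots> = (\<Sum>l<m'. A $$ (k, l) * (B *\<^sub>v block n' x l) $ i)"
    using B i by (simp add: block_def scalar_prod_def atLeast0LessThan sum_distrib_left mult.assoc)
  finally show ?thesis .
qed

lemma block_add:
  assumes "x \<in> carrier_vec (m * n)" "y \<in> carrier_vec (m * n)" "k < m"
  shows "block n (x + y) k = block n x k + block n y k"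
  using assms block_index_less[of k m _ n] by (auto simp: block_def)

lemma subdiag_mat_carrier[simp]: "subdiag_mat m \<in> carrier_mat m m"
  by (simp add: subdiag_mat_def)

lemma block_one_kron_mult_vec:
  fixes P :: "real mat"
  assumes P: "P \<in> carrier_mat n n" and x: "x \<in> carrier_vec (m * n)" and k: "k < m"
  shows "block n ((1\<^sub>m m \<otimes>\<^sub>K P) *\<^sub>v x) k = P *\<^sub>v block n x k"
proof (rule eq_vecI)
  fix i assume "i < dim_vec (P *\<^sub>v block n x k)"
  then have i: "i < n" using P by simp
  have "block n ((1\<^sub>m m \<otimes>\<^sub>K P) *\<^sub>v x) k $ i = (\<Sum>l<m. 1\<^sub>m m $$ (k, l) * (P *\<^sub>v block n x l) $ i)"
    by (rule block_kron_mult_vec[OF _ P x k i]) simp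
  also have "\<dots> = (\<Sum>l<m. if l = k then (P *\<^sub>v block n x l) $ i else 0)"
    using k by (intro sum.cong) auto
  finally show "block n ((1\<^sub>m m \<otimes>\<^sub>K P) *\<^sub>v x) k $ i = (P *\<^sub>v block n x k) $ i" using k by simp
qed (use P in \<open>auto simp: block_def\<close>)

lemma block_subdiag_kron_mult_vec:
  assumes P: "P \<in> carrier_mat n n" and x: "x \<in> carrier_vec (m * n)" and k: "k < m"
  shows "block n ((subdiag_mat m \<otimes>\<^sub>K P) *\<^sub>v x) k =
    P *\<^sub>v (case k of 0 \<Rightarrow> 0\<^sub>v n | Suc l \<Rightarrow> block n x l)"
proof (rule eq_vecI)
  fix i assume "i < dim_vec (P *\<^sub>v (case k of 0 \<Rightarrow> 0\<^sub>v n | Suc l \<Rightarrow> block n x l))"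
  then have i: "i < n" using P by simp
  have *: "block n ((subdiag_mat m \<otimes>\<^sub>K P) *\<^sub>v x) k $ i =
      (\<Sum>l<m. subdiag_mat m $$ (k, l) * (P *\<^sub>v block n x l) $ i)"
    by (rule block_kron_mult_vec[OF _ P x k i]) simp
  show "block n ((subdiag_mat m \<otimes>\<^sub>K P) *\<^sub>v x) k $ i =
      (P *\<^sub>v (case k of 0 \<Rightarrow> 0\<^sub>v n | Suc l \<Rightarrow> block n x l)) $ i"
  proof (cases k)
    case 0
    \<comment> \<open>The first row of the shift matrix is zero; this matches the default slice
      \<open>0\<^sub>v n\<close> in the statement.\<close>
    then show ?thesis unfolding * using k P i by (auto simp: subdiag_mat_def intro!: sum.neutral)
  next
    case (Suc j)
    have "(\<Sum>l<m. subdiag_mat m $$ (k, l) * (P *\<^sub>v block n x l) $ i) =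
        (\<Sum>l<m. if l = j then (P *\<^sub>v block n x l) $ i else 0)"
      using k Suc by (intro sum.cong) (auto simp: subdiag_mat_def)
    then show ?thesis unfolding * using k Suc by simp
  qed
qed (use P in \<open>auto simp: block_def\<close>)

section \<open>Algebra of Kronecker products\<close>

lemma kron_add_left:
  assumes "A \<in> carrier_mat m m'" "B \<in> carrier_mat m m'"
  shows "(A + B) \<otimes>\<^sub>K C = A \<otimes>\<^sub>K C + B \<otimes>\<^sub>K C"
proof (rule eq_matI)
  fix i j
  assume "i < dim_row (A \<otimes>\<^sub>K C + B \<otimes>\<^sub>K C)" "j < dim_col (A \<otimes>\<^sub>K C + B \<otimes>\<^sub>K C)"
  then have ij: "i < m * dim_row C" "j < m' * dim_col C" using assms by (auto simp: kron_def)
  then have "i div dim_row C < m" "j div dim_col C < m'" by (auto simp: less_mult_imp_div_less)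
  then show "((A + B) \<otimes>\<^sub>K C) $$ (i, j) = (A \<otimes>\<^sub>K C + B \<otimes>\<^sub>K C) $$ (i, j)"
    using assms ij by (simp add: kron_def distrib_right)
qed (use assms in \<open>auto simp: kron_def\<close>)

text \<open>The mixed-product rule. Decoding the summation index into a pair turns the entry of the
  product into a double sum, which factors.\<close>

lemma kron_mult_kron:
  fixes A :: "'a::comm_ring_1 mat"
  assumes A: "A \<in> carrier_mat m k" and B: "B \<in> carrier_mat n l"
    and C: "C \<in> carrier_mat k p" and D: "D \<in> carrier_mat l q"
  shows "(A \<otimes>\<^sub>K B) * (C \<otimes>\<^sub>K D) = (A * C) \<otimes>\<^sub>K (B * D)"
proof (rule eq_matI)
  fix i j
  assume "i < dim_row ((A * C) \<otimes>\<^sub>K (B * D))" "j < dim_col ((A * C) \<otimes>\<^sub>K (B * D))"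
  then have ij: "i < m * n" "j < p * q" using assms by (auto simp: kron_def)
  then have nq: "n > 0" "q > 0" by (auto intro: gr0I)
  have dm: "i div n < m" "j div q < p" "i mod n < n" "j mod q < q"
    using ij nq by (auto simp: less_mult_imp_div_less)
  have "((A \<otimes>\<^sub>K B) * (C \<otimes>\<^sub>K D)) $$ (i, j) = (\<Sum>r<k * l.
      A $$ (i div n, r div l) * B $$ (i mod n, r mod l) * (C $$ (r div l, j div q) * D $$ (r mod l, j mod q)))"
    using assms ij by (auto simp: kron_def scalar_prod_def atLeast0LessThan)
  also have "\<dots> = (\<Sum>r<k. \<Sum>s<l. A $$ (i div n, r) * B $$ (i mod n, s) * (C $$ (r, j div q) * D $$ (s, j mod q)))"
    by (rule sum_div_mod)
  also have "\<dots> = (\<Sum>r<k. A $$ (i div n, r) * C $$ (r, j div q)) * (\<Sum>s<l. B $$ (i mod n, s) * D $$ (s, j mod q))"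
    by (simp add: sum_product mult_ac)
  also have "\<dots> = ((A * C) \<otimes>\<^sub>K (B * D)) $$ (i, j)"
    using assms ij dm by (simp add: kron_def scalar_prod_def atLeast0LessThan)
  finally show "((A \<otimes>\<^sub>K B) * (C \<otimes>\<^sub>K D)) $$ (i, j) = ((A * C) \<otimes>\<^sub>K (B * D)) $$ (i, j)" .
qed (use assms in \<open>auto simp: kron_def\<close>)

lemma transpose_kron:
  "transpose_mat (A \<otimes>\<^sub>K B) = transpose_mat A \<otimes>\<^sub>K transpose_mat B"
proof (rule eq_matI)
  fix i j
  assume "i < dim_row (transpose_mat A \<otimes>\<^sub>K transpose_mat B)" "j < dim_col (transpose_mat A \<otimes>\<^sub>K transpose_mat B)"
  then have ij: "i < dim_col A * dim_col B" "j < dim_row A * dim_row B" by (auto simp: kron_def)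
  then have "dim_col B > 0" "dim_row B > 0" by (auto intro: gr0I)
  then show "transpose_mat (A \<otimes>\<^sub>K B) $$ (i, j) = (transpose_mat A \<otimes>\<^sub>K transpose_mat B) $$ (i, j)"
    using ij by (simp add: kron_def less_mult_imp_div_less)
qed (auto simp: kron_def)

lemma smult_smult_mat: "a \<cdot>\<^sub>m (b \<cdot>\<^sub>m A) = (a * b :: 'a::semigroup_mult) \<cdot>\<^sub>m A"
  by (rule eq_matI) (auto simp: mult.assoc)

text \<open>The index is shifted by one, so that the initial value \<open>u\<^sub>-\<^sub>1 = 0\<close> is \<open>lag n u 0\<close> and \<open>u\<^sub>k\<close> is
  \<open>lag n u (Suc k)\<close>.\<close>

definition lag :: "nat \<Rightarrow> 'a::zero vec \<Rightarrow> nat \<Rightarrow> 'a vec" where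
  "lag n x k = (case k of 0 \<Rightarrow> 0\<^sub>v n | Suc l \<Rightarrow> block n x l)"

lemma lag_carrier[simp]: "lag n x k \<in> carrier_vec n"
  by (simp add: lag_def split: nat.split)

lemma block_bidiagonal_mult_vec:
  assumes P: "P \<in> carrier_mat n n" and R: "R \<in> carrier_mat n n"
    and x: "x \<in> carrier_vec (m * n)" and k: "k < m"
  shows "block n ((1\<^sub>m m \<otimes>\<^sub>K P + subdiag_mat m \<otimes>\<^sub>K R) *\<^sub>v x) k =
    P *\<^sub>v lag n x (Suc k) + R *\<^sub>v lag n x k"
proof -
  have c: "1\<^sub>m m \<otimes>\<^sub>K P \<in> carrier_mat (m * n) (m * n)" "subdiag_mat m \<otimes>\<^sub>K R \<in> carrier_mat (m * n) (m * n)"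
    using P R by auto
  have "block n ((1\<^sub>m m \<otimes>\<^sub>K P + subdiag_mat m \<otimes>\<^sub>K R) *\<^sub>v x) k =
      block n ((1\<^sub>m m \<otimes>\<^sub>K P) *\<^sub>v x) k + block n ((subdiag_mat m \<otimes>\<^sub>K R) *\<^sub>v x) k"
    unfolding add_mult_distrib_mat_vec[OF c x]
    by (intro block_add[of _ m] mult_mat_vec_carrier[OF c(1) x] mult_mat_vec_carrier[OF c(2) x] k)
  then show ?thesis
    unfolding block_one_kron_mult_vec[OF P x k] block_subdiag_kron_mult_vec[OF R x k]
    by (simp add: lag_def)
qed

text \<open>Forward substitution: a kernel vector satisfies \<open>u_k = - u_(k-1)\<close> with zero
  initial value, so all its slices vanish in turn.\<close>

lemma det_bidiagonal_kron_one:
  "det ((1\<^sub>m m + subdiag_mat m) \<otimes>\<^sub>K 1\<^sub>m n) \<noteq> 0"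
proof
  let ?T = "(1\<^sub>m m + subdiag_mat m) \<otimes>\<^sub>K 1\<^sub>m n"
  have c: "?T \<in> carrier_mat (m * n) (m * n)" by simp
  have T: "?T = 1\<^sub>m m \<otimes>\<^sub>K 1\<^sub>m n + subdiag_mat m \<otimes>\<^sub>K 1\<^sub>m n" by (rule kron_add_left[of _ m m]) auto
  assume "det ?T = 0"
  then obtain x where x: "x \<in> carrier_vec (m * n)" "x \<noteq> 0\<^sub>v (m * n)" "?T *\<^sub>v x = 0\<^sub>v (m * n)"
    using det_0_iff_vec_prod_zero[OF c] by auto
  have step: "lag n x (Suc k) + lag n x k = 0\<^sub>v n" if "k < m" for k
  proof -
    have "block n (?T *\<^sub>v x) k = lag n x (Suc k) + lag n x k"
      unfolding T using block_bidiagonal_mult_vec[OF _ _ x(1) that, of "1\<^sub>m n" "1\<^sub>m n"] by simp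
    moreover have "block n (0\<^sub>v (m * n) :: real vec) k = 0\<^sub>v n"
      using block_index_less[OF that] by (auto simp: block_def)
    ultimately show ?thesis using x(3) by simp
  qed
  have zero: "lag n x k = 0\<^sub>v n" if "k \<le> m" for k
    using that
  proof (induction k)
    case (Suc k)
    then show ?case using step[of k] right_zero_vec[of "lag n x (Suc k)" n] by simp
  qed (simp add: lag_def)
  have "x = 0\<^sub>v (m * n)"
  proof (rule eq_vec_blockI[OF x(1)])
    fix k assume k: "k < m"
    then show "block n x k = block n (0\<^sub>v (m * n)) k"
      using zero[of "Suc k"] block_index_less[OF k] by (auto simp: lag_def block_def)
  qed simp
  with x(2) show False ..
qed

text \<open>The form is the sum of the forms of \<open>M\<close> over the slices, and a nonzero
  vector has a nonzero slice.\<close>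

lemma one_kron_pos_def:
  fixes M :: "real mat"
  assumes M: "M \<in> carrier_mat n n"
    and pos: "\<And>x. x \<in> carrier_vec n \<Longrightarrow> x \<noteq> 0\<^sub>v n \<Longrightarrow> x \<bullet>\<^sub>v (M *\<^sub>v x) > 0"
    and x: "x \<in> carrier_vec (m * n)" "x \<noteq> 0\<^sub>v (m * n)"
  shows "x \<bullet>\<^sub>v ((1\<^sub>m m \<otimes>\<^sub>K M) *\<^sub>v x) > 0"
proof -
  have c: "1\<^sub>m m \<otimes>\<^sub>K M \<in> carrier_mat (m * n) (m * n)" using M by simp
  have nonneg: "y \<bullet>\<^sub>v (M *\<^sub>v y) \<ge> 0" if "y \<in> carrier_vec n" for y
    using pos[OF that] M that by (cases "y = 0\<^sub>v n") (auto intro: less_imp_le)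
  obtain k where k: "k < m" "block n x k \<noteq> 0\<^sub>v n"
  proof (rule ccontr)
    assume "\<not> thesis"
    with that have *: "block n x k = 0\<^sub>v n" if "k < m" for k using that by blast
    have "x = 0\<^sub>v (m * n)"
    proof (rule eq_vec_blockI[OF x(1)])
      fix k assume k: "k < m"
      then show "block n x k = block n (0\<^sub>v (m * n)) k"
        using *[OF k] block_index_less[OF k] by (auto simp: block_def)
    qed simp
    with x(2) show False ..
  qed
  have "x \<bullet>\<^sub>v ((1\<^sub>m m \<otimes>\<^sub>K M) *\<^sub>v x) = (\<Sum>k<m. block n x k \<bullet>\<^sub>v (M *\<^sub>v block n x k))"
    by (subst scalar_prod_block[OF x(1) mult_mat_vec_carrier[OF c x(1)]])
      (simp add: block_one_kron_mult_vec[OF M x(1)])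
  also have "\<dots> > 0" using k by (intro sum_pos2[of _ k] pos nonneg) auto
  finally show ?thesis .
qed

text \<open>The right factor equals \<open>s L (a + b) + M (a - b)\<close>. Testing its second term
  with \<open>a + b\<close> leaves a difference of two energies, because the cross terms cancel by
  symmetry of \<open>M\<close>.\<close>

lemma crank_nicolson_step:
  fixes L M :: "real mat"
  assumes L: "L \<in> carrier_mat n n" and M: "M \<in> carrier_mat n n" "transpose_mat M = M"
    and a: "a \<in> carrier_vec n" and b: "b \<in> carrier_vec n"
  shows "(a + b) \<bullet>\<^sub>v ((s \<cdot>\<^sub>m L + M) *\<^sub>v a + (s \<cdot>\<^sub>m L - M) *\<^sub>v b) =
    s * ((a + b) \<bullet>\<^sub>v (L *\<^sub>v (a + b))) + a \<bullet>\<^sub>v (M *\<^sub>v a) - b \<bullet>\<^sub>v (M *\<^sub>v b)"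
proof -
  note c = mult_mat_vec_carrier[OF L a] mult_mat_vec_carrier[OF L b]
    mult_mat_vec_carrier[OF M(1) a] mult_mat_vec_carrier[OF M(1) b]
  have 1: "(s \<cdot>\<^sub>m L + M) *\<^sub>v a = s \<cdot>\<^sub>v (L *\<^sub>v a) + M *\<^sub>v a"
    using L M a by (simp add: add_mult_distrib_mat_vec[of _ n n] smult_mat_mult_vec[of _ n n])
  have 2: "(s \<cdot>\<^sub>m L - M) *\<^sub>v b = s \<cdot>\<^sub>v (L *\<^sub>v b) - M *\<^sub>v b"
    using L M b by (simp add: minus_mult_distrib_mat_vec[of _ n n] smult_mat_mult_vec[of _ n n])
  have 3: "L *\<^sub>v (a + b) = L *\<^sub>v a + L *\<^sub>v b" by (rule mult_add_distrib_mat_vec[OF L a b])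
  have 4: "a \<bullet>\<^sub>v (M *\<^sub>v b) = b \<bullet>\<^sub>v (M *\<^sub>v a)" by (rule sym_scalar_prod[OF M a b])
  show ?thesis
    unfolding 1 2 3 using a b c 4
    by (simp add: scalar_prod_add_distrib[of _ n] add_scalar_prod_distrib[of _ n]
        scalar_prod_minus_distrib[of _ n] algebra_simps)
qed

text \<open>A discrete energy balance: each step contributes a nonnegative dissipation plus an
  increment of energy, and the increments add up to the final energy, which is nonnegative.\<close>

lemma crank_nicolson_accretive:
  fixes L M :: "real mat"
  assumes L: "L \<in> carrier_mat n n" and M: "M \<in> carrier_mat n n" "transpose_mat M = M"
    and Lnonneg: "\<And>x. x \<in> carrier_vec n \<Longrightarrow> x \<bullet>\<^sub>v (L *\<^sub>v x) \<ge> 0"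
    and Mnonneg: "\<And>x. x \<in> carrier_vec n \<Longrightarrow> x \<bullet>\<^sub>v (M *\<^sub>v x) \<ge> 0"
    and s: "s \<ge> 0" and u: "u \<in> carrier_vec (m * n)"
  shows "(((1\<^sub>m m + subdiag_mat m) \<otimes>\<^sub>K 1\<^sub>m n) *\<^sub>v u) \<bullet>\<^sub>v
    ((1\<^sub>m m \<otimes>\<^sub>K (s \<cdot>\<^sub>m L + M) + subdiag_mat m \<otimes>\<^sub>K (s \<cdot>\<^sub>m L - M)) *\<^sub>v u) \<ge> 0"
proof -
  let ?T = "(1\<^sub>m m + subdiag_mat m) \<otimes>\<^sub>K 1\<^sub>m n :: real mat"
  let ?\<Lambda> = "1\<^sub>m m \<otimes>\<^sub>K (s \<cdot>\<^sub>m L + M) + subdiag_mat m \<otimes>\<^sub>K (s \<cdot>\<^sub>m L - M)"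
  have T: "?T = 1\<^sub>m m \<otimes>\<^sub>K 1\<^sub>m n + subdiag_mat m \<otimes>\<^sub>K 1\<^sub>m n" by (rule kron_add_left[of _ m m]) auto
  have Lpm: "s \<cdot>\<^sub>m L + M \<in> carrier_mat n n" "s \<cdot>\<^sub>m L - M \<in> carrier_mat n n" using L M by auto
  have c: "?T *\<^sub>v u \<in> carrier_vec (m * n)" "?\<Lambda> *\<^sub>v u \<in> carrier_vec (m * n)"
    by (rule mult_mat_vec_carrier[OF _ u]; use Lpm in auto)+
  define U where "U = lag n u"
  define f where "f k = U k \<bullet>\<^sub>v (M *\<^sub>v U k)" for k
  have U: "U k \<in> carrier_vec n" for k by (simp add: U_def)
  have "(?T *\<^sub>v u) \<bullet>\<^sub>v (?\<Lambda> *\<^sub>v u) = (\<Sum>k<m. block n (?T *\<^sub>v u) k \<bullet>\<^sub>v block n (?\<Lambda> *\<^sub>v u) k)"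
    by (rule scalar_prod_block[OF c])
  also have "\<dots> = (\<Sum>k<m. s * ((U (Suc k) + U k) \<bullet>\<^sub>v (L *\<^sub>v (U (Suc k) + U k))) + (f (Suc k) - f k))"
  proof (rule sum.cong[OF refl])
    fix k assume "k \<in> {..<m}"
    then have k: "k < m" by simp
    have "block n (?T *\<^sub>v u) k = U (Suc k) + U k"
      unfolding T using block_bidiagonal_mult_vec[OF _ _ u k, of "1\<^sub>m n" "1\<^sub>m n"] by (simp add: U_def)
    then show "block n (?T *\<^sub>v u) k \<bullet>\<^sub>v block n (?\<Lambda> *\<^sub>v u) k =
        s * ((U (Suc k) + U k) \<bullet>\<^sub>v (L *\<^sub>v (U (Suc k) + U k))) + (f (Suc k) - f k)"
      using block_bidiagonal_mult_vec[OF Lpm u k, folded U_def] crank_nicolson_step[OF L M U U]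
      by (simp add: f_def)
  qed
  also have "\<dots> = (\<Sum>k<m. s * ((U (Suc k) + U k) \<bullet>\<^sub>v (L *\<^sub>v (U (Suc k) + U k)))) + f m - f 0"
    by (simp add: sum.distrib sum_lessThan_telescope)
  \<comment> \<open>The telescoped sum loses its negative end because \<open>U 0\<close> is the zero
    initial value.\<close>
  also have "f 0 = 0" using M(1) by (simp add: f_def U_def lag_def)
  also have "(\<Sum>k<m. s * ((U (Suc k) + U k) \<bullet>\<^sub>v (L *\<^sub>v (U (Suc k) + U k)))) + f m - 0 \<ge> 0"
    using s U Lnonneg Mnonneg unfolding f_def by (simp add: sum_nonneg)
  finally show ?thesis .
qed

text \<open>The abstract estimate with \<open>c = 1 / sqrt \<beta>\<close>: relative to
  \<open>D\<close>, the matrix \<open>C\<close> carries the factor \<open>1 / \<beta>\<close>, the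
  square of the factor \<open>1 / sqrt \<beta>\<close> carried by \<open>H\<close>.\<close>

lemma all_at_once_schur_complement:
  fixes L M :: "real mat" and s \<beta> :: real
  assumes L: "L \<in> carrier_mat n n" and M: "M \<in> carrier_mat n n" "transpose_mat M = M"
    and Lnonneg: "\<And>x. x \<in> carrier_vec n \<Longrightarrow> x \<bullet>\<^sub>v (L *\<^sub>v x) \<ge> 0"
    and Mpos: "\<And>x. x \<in> carrier_vec n \<Longrightarrow> x \<noteq> 0\<^sub>v n \<Longrightarrow> x \<bullet>\<^sub>v (M *\<^sub>v x) > 0"
    and s: "s > 0" and \<beta>: "\<beta> > 0"
    and D: "D = s \<cdot>\<^sub>m (1\<^sub>m m \<otimes>\<^sub>K M)"
    and C: "C = (s / \<beta>) \<cdot>\<^sub>m (1\<^sub>m m \<otimes>\<^sub>K M)"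
    and T: "T = (1\<^sub>m m + subdiag_mat m) \<otimes>\<^sub>K 1\<^sub>m n"
    and \<Lambda>: "\<Lambda> = 1\<^sub>m m \<otimes>\<^sub>K (s \<cdot>\<^sub>m L + M) + subdiag_mat m \<otimes>\<^sub>K (s \<cdot>\<^sub>m L - M)"
    and H: "H = (s / sqrt \<beta>) \<cdot>\<^sub>m ((1\<^sub>m m + subdiag_mat m) \<otimes>\<^sub>K M)"
    and A: "A = transpose_mat T * D * T"
    and B: "B = \<Lambda> * mat_inv T"
    and S: "S = C + B * mat_inv D * transpose_mat B"
    and St: "St = (\<Lambda> + H) * mat_inv A * transpose_mat (\<Lambda> + H)"
  shows "invertible_mat T" "invertible_mat D" "invertible_mat A" "invertible_mat St"
    "eigenvalue (map_mat complex_of_real (mat_inv St * S)) \<mu> \<Longrightarrow> \<mu> \<in> complex_of_real ` {1/2..1}"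
proof -
  have IM: "1\<^sub>m m \<otimes>\<^sub>K M \<in> carrier_mat (m * n) (m * n)" using M by simp
  have Dc: "D \<in> carrier_mat (m * n) (m * n)" using IM by (simp add: D)
  have Dsym: "transpose_mat D = D" by (simp add: D transpose_smult_mat transpose_kron M)
  have Dpos: "x \<bullet>\<^sub>v (D *\<^sub>v x) > 0" if x: "x \<in> carrier_vec (m * n)" "x \<noteq> 0\<^sub>v (m * n)" for x
    unfolding D smult_mat_mult_vec[OF IM x(1)]
    using one_kron_pos_def[OF M(1) Mpos x] s x(1) mult_mat_vec_carrier[OF IM x(1)] by simp
  have Tc: "T \<in> carrier_mat (m * n) (m * n)" by (simp add: T)
  have dT: "det T \<noteq> 0" unfolding T by (rule det_bidiagonal_kron_one)
  have \<Lambda>c: "\<Lambda> \<in> carrier_mat (m * n) (m * n)" unfolding \<Lambda> using L M(1) by (intro add_carrier_mat kron_carrier) auto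
  have Mnonneg: "x \<bullet>\<^sub>v (M *\<^sub>v x) \<ge> 0" if "x \<in> carrier_vec n" for x
    using Mpos[OF that] M(1) that by (cases "x = 0\<^sub>v n") (auto intro: less_imp_le)
  have acc: "(T *\<^sub>v u) \<bullet>\<^sub>v (\<Lambda> *\<^sub>v u) \<ge> 0" if "u \<in> carrier_vec (m * n)" for u
    unfolding T \<Lambda> using s that by (intro crank_nicolson_accretive L M Lnonneg Mnonneg) auto
  \<comment> \<open>The mixed-product rule recognizes the bidiagonal mass matrix in \<open>H\<close>
    as \<open>D T\<close> up to a scalar.\<close>
  have "(1\<^sub>m m \<otimes>\<^sub>K M) * T = (1\<^sub>m m + subdiag_mat m) \<otimes>\<^sub>K M"
    unfolding T using M by (simp add: kron_mult_kron[of _ m m _ n n _ m _ n] left_mult_one_mat[of _ m m])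
  then have H': "H = (1 / sqrt \<beta>) \<cdot>\<^sub>m (D * T)"
    unfolding H D using IM Tc by (simp add: mult_smult_assoc_mat[of _ "m * n" "m * n"] smult_smult_mat)
  have C': "C = (1 / sqrt \<beta>)\<^sup>2 \<cdot>\<^sub>m D"
    unfolding C D using \<beta> by (simp add: power_divide smult_smult_mat)
  have c: "1 / sqrt \<beta> > 0" using \<beta> by simp
  note * = preconditioned_schur_complement[OF Dc Dsym Dpos Tc dT \<Lambda>c acc c H' C' A B S St]
  show "invertible_mat T" "invertible_mat D" "invertible_mat A" "invertible_mat St" by (rule *; assumption)+
  show "\<mu> \<in> complex_of_real ` {1/2..1}" if "eigenvalue (map_mat complex_of_real (mat_inv St * S)) \<mu>"
    by (rule *(5)[OF _ _ _ that])
qed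

section \<open>Finite element matrices\<close>

lemma grad_eqI: "GDERIV f x :> D \<Longrightarrow> grad f x = D"
proof -
  assume D: "GDERIV f x :> D"
  have "D' = D" if "GDERIV f x :> D'" for D'
  proof -
    have "(\<lambda>h. h \<bullet> D') = (\<lambda>h. h \<bullet> D)"
      using has_derivative_unique that D unfolding gderiv_def by blast
    then show ?thesis by (metis vector_eq_ldot)
  qed
  then show ?thesis unfolding grad_def using D by blast
qed

text \<open>Induction on the polynomial, by the sum and product rules. Continuity of the gradient is
  recorded for the sake of integrability on compact elements.\<close>

lemma real_polynomial_gradient:
  fixes p :: "'a::euclidean_space \<Rightarrow> real"
  assumes "real_polynomial_function p"
  shows "\<exists>g. continuous_on UNIV g \<and> (\<forall>x. GDERIV p x :> g x)"
  using assms
proof induction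
  case (linear f)
  \<comment> \<open>The Riesz representative of the linear functional \<open>f\<close>.\<close>
  define D where "D = (\<Sum>b\<in>Basis. f b *\<^sub>R b)"
  have "f h = h \<bullet> D" for h
  proof -
    have "f h = f (\<Sum>b\<in>Basis. (h \<bullet> b) *\<^sub>R b)" by (simp add: euclidean_representation)
    also have "\<dots> = h \<bullet> D"
      using linear by (simp add: linear_sum linear_cmul bounded_linear.linear D_def inner_sum_right mult.commute)
    finally show ?thesis .
  qed
  then have "f = (\<lambda>h. h \<bullet> D)" by auto
  then have "GDERIV f x :> D" for x
    unfolding gderiv_def using bounded_linear_imp_has_derivative[OF linear] by metis
  then show ?case by (intro exI[of _ "\<lambda>_. D"]) auto
next
  case (const c)
  show ?case by (intro exI[of _ "\<lambda>_. 0"]) (simp add: GDERIV_const)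
next
  case (add p q)
  then obtain g g' where "continuous_on UNIV g" "\<forall>x. GDERIV p x :> g x"
    "continuous_on UNIV g'" "\<forall>x. GDERIV q x :> g' x" by blast
  then show ?case
    by (intro exI[of _ "\<lambda>x. g x + g' x"]) (auto intro: continuous_on_add GDERIV_add)
next
  case (mult p q)
  then obtain g g' where g: "continuous_on UNIV g" "\<forall>x. GDERIV p x :> g x"
    "continuous_on UNIV g'" "\<forall>x. GDERIV q x :> g' x" by blast
  have "continuous_on UNIV p" "continuous_on UNIV q"
    using g(2,4) unfolding gderiv_def
    by (meson continuous_at_imp_continuous_on has_derivative_continuous)+
  then show ?case using g
    by (intro exI[of _ "\<lambda>x. p x *\<^sub>R g' x + q x *\<^sub>R g x"])
      (auto intro!: continuous_intros GDERIV_mult)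
qed

text \<open>Near an interior point of an element, \<open>v\<close> coincides with a polynomial and
  so shares its gradient; that gradient extends continuously to the whole closed element.\<close>

lemma cont_piecewise_poly_gradient:
  assumes "cont_piecewise_poly \<Omega> \<T> v" "T \<in> \<T>"
  obtains g where "continuous_on T g" "\<And>x. x \<in> interior T \<Longrightarrow> GDERIV v x :> g x"
proof -
  obtain p where p: "real_polynomial_function p" "\<And>x. x \<in> T \<Longrightarrow> v x = p x"
    using assms unfolding cont_piecewise_poly_def by blast
  obtain g where g: "continuous_on UNIV g" "\<And>x. GDERIV p x :> g x"
    using real_polynomial_gradient[OF p(1)] by blast
  have "GDERIV v x :> g x" if "x \<in> interior T" for x
    unfolding gderiv_def
    by (rule has_derivative_transform_within_open[of p _ _ _ "interior T"])
      (use g(2)[of x] that p(2)[symmetric] interior_subset[of T] in \<open>auto simp: gderiv_def\<close>)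
  with g(1) that show thesis by (meson continuous_on_subset subset_UNIV)
qed

text \<open>The polynomial degree is unrestricted, so products of finite element functions are
  admissible in Green's formula.\<close>

lemma cont_piecewise_poly_mult:
  assumes "cont_piecewise_poly \<Omega> \<T> u" "cont_piecewise_poly \<Omega> \<T> v"
  shows "cont_piecewise_poly \<Omega> \<T> (\<lambda>x. u x * v x)"
  unfolding cont_piecewise_poly_def
proof (intro conjI ballI)
  show "continuous_on (closure \<Omega>) (\<lambda>x. u x * v x)"
    using assms by (auto simp: cont_piecewise_poly_def intro!: continuous_intros)
  fix T assume "T \<in> \<T>"
  then obtain p q where "real_polynomial_function p" "\<forall>x\<in>T. u x = p x"
    "real_polynomial_function q" "\<forall>x\<in>T. v x = q x"
    using assms unfolding cont_piecewise_poly_def by metis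
  then show "\<exists>p. real_polynomial_function p \<and> (\<forall>x\<in>T. u x * v x = p x)"
    by (intro exI[of _ "\<lambda>x. p x * q x"]) auto
qed

text \<open>Continuity up to the boundary of each element, with values on the element boundaries
  left free: gradients jump there, and the boundaries are null sets.\<close>

definition piecewise_cont :: "'a::euclidean_space set set \<Rightarrow> ('a \<Rightarrow> 'b::euclidean_space) \<Rightarrow> bool" where
  "piecewise_cont \<T> f \<longleftrightarrow>
     (\<forall>T\<in>\<T>. \<exists>g. continuous_on T g \<and> (\<forall>x\<in>interior T. f x = g x))"

lemma piecewise_cont_continuous_on:
  "continuous_on (\<Union>\<T>) f \<Longrightarrow> piecewise_cont \<T> f"
  unfolding piecewise_cont_def using continuous_on_subset Union_upper by blast

lemma piecewise_cont_inner:
  assumes "piecewise_cont \<T> f" "piecewise_cont \<T> g"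
  shows "piecewise_cont \<T> (\<lambda>x. f x \<bullet> g x)"
  unfolding piecewise_cont_def
proof
  fix T assume "T \<in> \<T>"
  then obtain f' g' where "continuous_on T f'" "\<forall>x\<in>interior T. f x = f' x"
    "continuous_on T g'" "\<forall>x\<in>interior T. g x = g' x"
    using assms unfolding piecewise_cont_def by metis
  then show "\<exists>h. continuous_on T h \<and> (\<forall>x\<in>interior T. f x \<bullet> g x = h x)"
    by (intro exI[of _ "\<lambda>x. f' x \<bullet> g' x"]) (auto intro!: continuous_intros)
qed

lemma piecewise_cont_diff_const:
  assumes "piecewise_cont \<T> f"
  shows "piecewise_cont \<T> (\<lambda>x. f x - c)"
  unfolding piecewise_cont_def
proof
  fix T assume "T \<in> \<T>"
  then obtain f' where "continuous_on T f'" "\<forall>x\<in>interior T. f x = f' x"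
    using assms unfolding piecewise_cont_def by metis
  then show "\<exists>h. continuous_on T h \<and> (\<forall>x\<in>interior T. f x - c = h x)"
    by (intro exI[of _ "\<lambda>x. f' x - c"]) (auto intro!: continuous_intros)
qed

lemma piecewise_cont_grad:
  assumes "cont_piecewise_poly \<Omega> \<T> v"
  shows "piecewise_cont \<T> (grad v)"
  unfolding piecewise_cont_def
proof
  fix T assume "T \<in> \<T>"
  then obtain g where "continuous_on T g" "\<And>x. x \<in> interior T \<Longrightarrow> GDERIV v x :> g x"
    using cont_piecewise_poly_gradient[OF assms] by blast
  then show "\<exists>g. continuous_on T g \<and> (\<forall>x\<in>interior T. grad v x = g x)"
    by (intro exI[of _ g]) (auto intro: grad_eqI)
qed

text \<open>On a compact element the continuous extension is integrable, and \<open>f\<close>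
  differs from it at most on the negligible frontier; a union of finitely many elements preserves
  this.\<close>

lemma absolutely_integrable_on_piecewise_cont:
  assumes mesh: "fe_mesh \<Omega> \<T>" and f: "piecewise_cont \<T> f" and p: "p \<subseteq> \<T>"
  shows "f absolutely_integrable_on \<Union>p"
proof -
  have fin: "finite p" using mesh p finite_subset unfolding fe_mesh_def by blast
  have T: "compact T" "negligible (frontier T)" if "T \<in> p" for T
    using mesh p that unfolding fe_mesh_def by auto
  have "f absolutely_integrable_on T" if "T \<in> p" for T
  proof -
    obtain g where g: "continuous_on T g" "\<And>x. x \<in> interior T \<Longrightarrow> f x = g x"
      using f p \<open>T \<in> p\<close> unfolding piecewise_cont_def by blast
    have "integrable lborel (\<lambda>x. indicator T x *\<^sub>R g x)"
      by (rule borel_integrable_compact[OF T(1)[OF that] g(1)])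
    then have "g absolutely_integrable_on T"
      unfolding set_integrable_def
      using integrable_completion[of _ lborel] borel_measurable_integrable by blast
    then show ?thesis
      using g(2) by (rule absolutely_integrable_spike[OF _ T(2)[OF that]])
        (use compact_imp_closed[OF T(1)[OF that]] in \<open>auto simp: frontier_def\<close>)
  qed
  then show ?thesis
    using set_integrable_UN[OF fin, of lebesgue "\<lambda>T. T" f] T(1) by (auto simp: lmeasurable_compact fmeasurableD)
qed

lemma absolutely_integrable_on_domain:
  assumes mesh: "fe_mesh \<Omega> \<T>" and \<Omega>: "open \<Omega>" and f: "piecewise_cont \<T> f"
  shows "f absolutely_integrable_on \<Omega>"
proof (rule set_integrable_subset)
  show "f absolutely_integrable_on \<Union>\<T>"
    by (rule absolutely_integrable_on_piecewise_cont[OF mesh f]) simp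
  show "\<Omega> \<subseteq> \<Union>\<T>" using mesh closure_subset unfolding fe_mesh_def by auto
qed (use \<Omega> in auto)

text \<open>Bilinearity of the inner product; integrability of the entries permits exchanging the
  finite sums with the integral.\<close>

lemma gram_integral:
  fixes u :: "nat \<Rightarrow> 'a \<Rightarrow> 'b::real_inner"
  assumes "\<And>i j. i < n \<Longrightarrow> j < n \<Longrightarrow> set_integrable M S (\<lambda>x. u i x \<bullet> u j x)"
  shows "(\<Sum>i<n. \<Sum>j<n. c i * c j * (LINT x:S|M. u i x \<bullet> u j x)) =
    (LINT x:S|M. (\<Sum>i<n. c i *\<^sub>R u i x) \<bullet> (\<Sum>i<n. c i *\<^sub>R u i x))"
proof -
  have int: "integrable M (\<lambda>x. c i * c j * (indicator S x *\<^sub>R (u i x \<bullet> u j x)))" if "i < n" "j < n" for i j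
    using assms[OF that] unfolding set_integrable_def by (rule integrable_mult_right)
  have "indicator S x *\<^sub>R ((\<Sum>i<n. c i *\<^sub>R u i x) \<bullet> (\<Sum>j<n. c j *\<^sub>R u j x)) =
      (\<Sum>i<n. \<Sum>j<n. c i * c j * (indicator S x *\<^sub>R (u i x \<bullet> u j x)))" for x
    unfolding inner_sum_left scaleR_sum_right
    by (intro sum.cong refl) (simp add: inner_sum_right sum_distrib_left mult_ac)
  then have "(LINT x:S|M. (\<Sum>i<n. c i *\<^sub>R u i x) \<bullet> (\<Sum>j<n. c j *\<^sub>R u j x)) =
      (LINT x|M. (\<Sum>i<n. \<Sum>j<n. c i * c j * (indicator S x *\<^sub>R (u i x \<bullet> u j x))))"
    unfolding set_lebesgue_integral_def by (simp only:)
  also have "\<dots> = (\<Sum>i<n. (LINT x|M. (\<Sum>j<n. c i * c j * (indicator S x *\<^sub>R (u i x \<bullet> u j x)))))"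
    by (intro Bochner_Integration.integral_sum Bochner_Integration.integrable_sum int) auto
  also have "\<dots> = (\<Sum>i<n. \<Sum>j<n. (LINT x|M. c i * c j * (indicator S x *\<^sub>R (u i x \<bullet> u j x))))"
    by (intro sum.cong refl Bochner_Integration.integral_sum int) auto
  finally show ?thesis by (simp add: set_lebesgue_integral_def)
qed

lemma gram_integral_nonneg:
  fixes u :: "nat \<Rightarrow> 'a \<Rightarrow> 'b::real_inner"
  assumes "\<And>i j. i < n \<Longrightarrow> j < n \<Longrightarrow> set_integrable M S (\<lambda>x. u i x \<bullet> u j x)"
  shows "(\<Sum>i<n. \<Sum>j<n. c i * c j * (LINT x:S|M. u i x \<bullet> u j x)) \<ge> 0"
proof (subst gram_integral[OF assms])
  show "(LINT x:S|M. (\<Sum>i<n. c i *\<^sub>R u i x) \<bullet> (\<Sum>i<n. c i *\<^sub>R u i x)) \<ge> 0"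
    unfolding set_lebesgue_integral_def by (rule Bochner_Integration.integral_nonneg) simp
qed

section \<open>Definiteness and skew-symmetry of the finite element matrices\<close>

lemma quadratic_form_mat:
  fixes x :: "real vec"
  assumes "x \<in> carrier_vec n"
  shows "x \<bullet>\<^sub>v (Matrix.mat n n f *\<^sub>v x) = (\<Sum>i<n. \<Sum>j<n. x $ i * x $ j * f (i, j))"
proof -
  have "x \<bullet>\<^sub>v (Matrix.mat n n f *\<^sub>v x) = (\<Sum>i<n. x $ i * (\<Sum>j<n. f (i, j) * x $ j))"
    using assms by (simp add: scalar_prod_def atLeast0LessThan)
  also have "\<dots> = (\<Sum>i<n. \<Sum>j<n. x $ i * x $ j * f (i, j))"
    unfolding sum_distrib_left by (intro sum.cong refl) (simp add: mult_ac)
  finally show ?thesis .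
qed

text \<open>Green's formula is applied to the product \<open>u v\<close>. By the product rule and
  the vanishing divergence its volume integrand is almost everywhere the sum of the two convection
  integrands, and the boundary integrand vanishes because of \<open>u\<close> on the Dirichlet part
  and of the wind on the Neumann part.\<close>

lemma convection_skew:
  fixes w :: "'a::euclidean_space \<Rightarrow> 'a"
  assumes mesh: "fe_mesh \<Omega> \<T>" and \<Omega>: "open \<Omega>"
    and boundary: "\<Gamma>\<^sub>D \<union> \<Gamma>\<^sub>N = frontier \<Omega>"
    and u: "cont_piecewise_poly \<Omega> \<T> u" "\<forall>x\<in>\<Gamma>\<^sub>D. u x = 0"
    and v: "cont_piecewise_poly \<Omega> \<T> v"
    and w: "continuous_on (closure \<Omega>) w" "greens_formula \<Omega> \<T> w"
      "AE x in lebesgue. x \<in> \<Omega> \<longrightarrow> w differentiable (at x) \<and> divergence w x = 0"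
      "\<forall>x\<in>\<Gamma>\<^sub>N. w x \<bullet> outer_normal \<Omega> x = 0"
  shows "(LINT x:\<Omega>|lebesgue. (w x \<bullet> grad v x) * u x) = - (LINT x:\<Omega>|lebesgue. (w x \<bullet> grad u x) * v x)"
proof -
  let ?z = "\<lambda>x. u x * v x"
  let ?F = "\<lambda>x. (w x \<bullet> grad v x) * u x + (w x \<bullet> grad u x) * v x"
  let ?G = "\<lambda>x. w x \<bullet> grad ?z x + ?z x * divergence w x"
  have cl: "\<Union>\<T> = closure \<Omega>" using mesh by (simp add: fe_mesh_def)
  have pc: "piecewise_cont \<T> w" "piecewise_cont \<T> u" "piecewise_cont \<T> v"
    using w(1) u v by (auto simp: cl cont_piecewise_poly_def intro!: piecewise_cont_continuous_on)
  have pcg: "piecewise_cont \<T> (grad u)" "piecewise_cont \<T> (grad v)"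
    using u v by (auto intro: piecewise_cont_grad)
  have iv: "(\<lambda>x. (w x \<bullet> grad v x) * u x) absolutely_integrable_on \<Omega>"
    using absolutely_integrable_on_domain[OF mesh \<Omega> piecewise_cont_inner[OF piecewise_cont_inner[OF pc(1) pcg(2)] pc(2)]]
    by (simp only: inner_real_def)
  have iu: "(\<lambda>x. (w x \<bullet> grad u x) * v x) absolutely_integrable_on \<Omega>"
    using absolutely_integrable_on_domain[OF mesh \<Omega> piecewise_cont_inner[OF piecewise_cont_inner[OF pc(1) pcg(1)] pc(3)]]
    by (simp only: inner_real_def)
  \<comment> \<open>The exceptional set: points where the wind is not differentiable or not
    divergence-free, and the element boundaries, where the product rule may fail.\<close>
  define Z where "Z = {x. \<not> (x \<in> \<Omega> \<longrightarrow> w differentiable (at x) \<and> divergence w x = 0)} \<union> \<Union>(frontier ` \<T>)"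
  \<comment> \<open>An almost-everywhere statement provides a null superset of the exceptional
    points, from which \<open>Z\<close> inherits negligibility.\<close>
  obtain Y where Y: "Y \<in> null_sets lebesgue"
    "{x. \<not> (x \<in> \<Omega> \<longrightarrow> w differentiable (at x) \<and> divergence w x = 0)} \<subseteq> Y"
    using w(3) unfolding eventually_ae_filter by auto
  have "negligible (Y \<union> \<Union>(frontier ` \<T>))"
    using Y(1) mesh by (intro negligible_Un negligible_Union) (auto simp: negligible_iff_null_sets[symmetric] fe_mesh_def)
  then have "negligible Z" by (rule negligible_subset) (use Y(2) in \<open>auto simp: Z_def\<close>)
  have GF: "?G x = ?F x" if x: "x \<in> \<Omega> - Z" for x
  proof -
    obtain T where T: "T \<in> \<T>" "x \<in> T" using x cl closure_subset by blast
    then have "compact T" "x \<notin> frontier T" using mesh x by (auto simp: fe_mesh_def Z_def)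
    then have "x \<in> interior T" using T(2) by (simp add: frontier_def compact_imp_closed)
    then obtain Du Dv where D: "GDERIV u x :> Du" "GDERIV v x :> Dv"
      using cont_piecewise_poly_gradient[OF u(1) T(1)] cont_piecewise_poly_gradient[OF v T(1)] by metis
    have "divergence w x = 0" using x by (auto simp: Z_def)
    then show ?thesis
      using grad_eqI[OF D(1)] grad_eqI[OF D(2)] grad_eqI[OF GDERIV_mult[OF D]]
      by (simp add: inner_add_right mult.commute)
  qed
  have iF: "?F absolutely_integrable_on \<Omega>" using set_integral_add(1)[OF iv iu] .
  \<comment> \<open>Integrability of \<open>?G\<close> is inherited from \<open>?F\<close>, from
    which it differs on \<open>\<Omega>\<close> only within \<open>Z\<close>.\<close>
  have iG: "?G absolutely_integrable_on \<Omega>"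
    by (rule absolutely_integrable_spike[OF iF \<open>negligible Z\<close> GF])
  have "(LINT x:\<Omega>|lebesgue. ?F x) = (LINT x:\<Omega>|lebesgue. ?G x)"
    unfolding set_lebesgue_integral_eq_integral(2)[OF iF] set_lebesgue_integral_eq_integral(2)[OF iG]
    by (rule integral_spike[OF \<open>negligible Z\<close>]) (use GF in auto)
  also have "\<dots> = (LINT x:frontier \<Omega>|surface_measure. ?z x * (w x \<bullet> outer_normal \<Omega> x))"
    using w(2) cont_piecewise_poly_mult[OF u(1) v] unfolding greens_formula_def by blast
  also have "\<dots> = 0"
  proof -
    have "indicator (frontier \<Omega>) x *\<^sub>R (?z x * (w x \<bullet> outer_normal \<Omega> x)) = 0" for x
      using boundary u(2) w(4) by (auto simp: indicator_def)
    then show ?thesis unfolding set_lebesgue_integral_def by (simp only: Bochner_Integration.integral_zero)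
  qed
  finally show ?thesis using set_integral_add(2)[OF iv iu] by simp
qed

text \<open>Interchanging the two indices turns the sum into its own negative.\<close>

lemma skew_form_zero:
  assumes "\<And>i j. i < n \<Longrightarrow> j < n \<Longrightarrow> f i j = - f j (i::nat)"
  shows "(\<Sum>i<n. \<Sum>j<n. x i * x j * f i j) = (0::real)"
proof -
  have "(\<Sum>i<n. \<Sum>j<n. x i * x j * f i j) = (\<Sum>j<n. \<Sum>i<n. x i * x j * f i j)" by (rule sum.swap)
  also have "\<dots> = (\<Sum>j<n. \<Sum>i<n. - (x j * x i * f j i))"
  proof (intro sum.cong refl)
    fix i j assume "j \<in> {..<n}" "i \<in> {..<n}"
    then show "x i * x j * f i j = - (x j * x i * f j i)" using assms[of i j] by simp
  qed
  also have "\<dots> = - (\<Sum>j<n. \<Sum>i<n. x j * x i * f j i)" by (simp add: sum_negf)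
  finally show ?thesis by simp
qed

text \<open>If the integral were zero, \<open>v\<close> would vanish almost everywhere; but the set
  where it does not vanish is open and nonempty, hence not negligible.\<close>

lemma continuous_square_integral_pos:
  fixes v :: "'a::euclidean_space \<Rightarrow> real"
  assumes \<Omega>: "open \<Omega>" and v: "continuous_on \<Omega> v"
    and int: "(\<lambda>x. v x * v x) absolutely_integrable_on \<Omega>" and x: "x \<in> \<Omega>" "v x \<noteq> 0"
  shows "(LINT x:\<Omega>|lebesgue. v x * v x) > 0"
proof (rule ccontr)
  let ?f = "\<lambda>x. indicator \<Omega> x *\<^sub>R (v x * v x)"
  assume "\<not> ?thesis"
  moreover have "integral\<^sup>L lebesgue ?f \<ge> 0" by (rule Bochner_Integration.integral_nonneg) simp
  ultimately have "integral\<^sup>L lebesgue ?f = 0" unfolding set_lebesgue_integral_def by linarith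
  then have "AE x in lebesgue. ?f x = 0"
    using integral_nonneg_eq_0_iff_AE[of lebesgue ?f] int unfolding set_integrable_def by simp
  then have "AE y in lebesgue. \<not> (y \<in> \<Omega> \<and> v y \<noteq> 0)" by (rule eventually_mono) auto
  then obtain Y where Y: "Y \<in> null_sets lebesgue" "{y \<in> \<Omega>. v y \<noteq> 0} \<subseteq> Y"
    unfolding eventually_ae_filter by auto
  have "negligible {y \<in> \<Omega>. v y \<noteq> 0}"
    by (rule negligible_subset[OF _ Y(2)]) (use Y(1) in \<open>simp only: negligible_iff_null_sets\<close>)
  moreover have "open (\<Omega> \<inter> v -` (- {0}))"
    by (rule continuous_open_preimage[OF v \<Omega>]) (rule open_Compl, rule closed_singleton)
  moreover have "\<Omega> \<inter> v -` (- {0}) = {y \<in> \<Omega>. v y \<noteq> 0}" by auto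
  ultimately show False using x open_not_negligible[of "{y \<in> \<Omega>. v y \<noteq> 0}"] by auto
qed

lemma stab_param_nonneg:
  assumes "h > 0"
  shows "stab_param \<epsilon> w h P \<ge> 0"
proof (cases "peclet \<epsilon> w h P > 1")
  case True
  then have "1 - 1 / peclet \<epsilon> w h P \<ge> 0" by simp
  then show ?thesis using True assms by (simp add: stab_param_def)
qed (simp add: stab_param_def)

text \<open>The form at \<open>x\<close> is the squared \<open>L2\<close> norm of the finite element
  function with coefficients \<open>x\<close>. Linear independence on \<open>\<Omega>\<close> yields
  a point of \<open>\<Omega>\<close> where that function is nonzero.\<close>

lemma mass_mat_pos_def:
  assumes mesh: "fe_mesh \<Omega> \<T>" and \<Omega>: "open \<Omega>"
    and \<phi>: "\<forall>i<n. cont_piecewise_poly \<Omega> \<T> (\<phi> i)" "lin_indep_on \<Omega> n \<phi>"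
    and x: "x \<in> carrier_vec n" "x \<noteq> 0\<^sub>v n"
  shows "x \<bullet>\<^sub>v (mass_mat \<Omega> n \<phi> *\<^sub>v x) > 0"
proof -
  have cl: "\<Union>\<T> = closure \<Omega>" using mesh by (simp add: fe_mesh_def)
  have cont: "continuous_on (closure \<Omega>) (\<phi> i)" if "i < n" for i
    using \<phi>(1) that by (simp add: cont_piecewise_poly_def)
  define v where "v y = (\<Sum>i<n. x $ i * \<phi> i y)" for y
  have v: "continuous_on (closure \<Omega>) v"
    unfolding v_def by (intro continuous_intros cont) simp
  have iv: "(\<lambda>y. v y * v y) absolutely_integrable_on \<Omega>"
    by (intro absolutely_integrable_on_domain[OF mesh \<Omega>] piecewise_cont_continuous_on)
      (auto simp: cl intro!: continuous_intros v)
  have int: "set_integrable lebesgue \<Omega> (\<lambda>y. \<phi> i y \<bullet> \<phi> j y)" if "i < n" "j < n" for i j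
    using that by (intro absolutely_integrable_on_domain[OF mesh \<Omega>] piecewise_cont_continuous_on)
      (auto simp: cl intro!: continuous_intros cont)
  have "\<exists>y\<in>\<Omega>. v y \<noteq> 0"
  proof (rule ccontr)
    assume "\<not> ?thesis"
    then have "\<forall>y\<in>\<Omega>. (\<Sum>i<n. x $ i * \<phi> i y) = 0" by (simp add: v_def)
    then have "\<forall>i<n. x $ i = 0" using \<phi>(2) unfolding lin_indep_on_def by blast
    then show False using x by (auto intro: eq_vecI)
  qed
  then obtain y where y: "y \<in> \<Omega>" "v y \<noteq> 0" by blast
  have "x \<bullet>\<^sub>v (mass_mat \<Omega> n \<phi> *\<^sub>v x) = (LINT y:\<Omega>|lebesgue. v y * v y)"
    unfolding mass_mat_def quadratic_form_mat[OF x(1)]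
    using gram_integral[OF int, where c = "\<lambda>i. x $ i"] by (simp add: v_def)
  also have "\<dots> > 0"
    using continuous_square_integral_pos[OF \<Omega> continuous_on_subset[OF v closure_subset] iv y] .
  finally show ?thesis .
qed

lemma stiffness_mat_nonneg:
  assumes mesh: "fe_mesh \<Omega> \<T>" and \<Omega>: "open \<Omega>"
    and \<phi>: "\<forall>i<n. cont_piecewise_poly \<Omega> \<T> (\<phi> i)" and x: "x \<in> carrier_vec n"
  shows "x \<bullet>\<^sub>v (stiffness_mat \<Omega> n \<phi> *\<^sub>v x) \<ge> 0"
  unfolding stiffness_mat_def quadratic_form_mat[OF x] prod.case
  by (rule gram_integral_nonneg)
    (use \<phi> in \<open>auto intro!: absolutely_integrable_on_domain[OF mesh \<Omega>] piecewise_cont_inner piecewise_cont_grad\<close>)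

lemma convection_mat_skew:
  assumes mesh: "fe_mesh \<Omega> \<T>" and \<Omega>: "open \<Omega>"
    and boundary: "\<Gamma>\<^sub>D \<union> \<Gamma>\<^sub>N = frontier \<Omega>"
    and \<phi>: "\<forall>i<n. cont_piecewise_poly \<Omega> \<T> (\<phi> i)" "\<forall>i<n. \<forall>x\<in>\<Gamma>\<^sub>D. \<phi> i x = 0"
    and w: "continuous_on (closure \<Omega>) w" "greens_formula \<Omega> \<T> w"
      "AE x in lebesgue. x \<in> \<Omega> \<longrightarrow> w differentiable (at x) \<and> divergence w x = 0"
      "\<forall>x\<in>\<Gamma>\<^sub>N. w x \<bullet> outer_normal \<Omega> x = 0"
    and x: "x \<in> carrier_vec n"
  shows "x \<bullet>\<^sub>v (convection_mat \<Omega> w n \<phi> *\<^sub>v x) = 0"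
  unfolding convection_mat_def quadratic_form_mat[OF x] prod.case
  by (rule skew_form_zero, rule convection_skew[OF mesh \<Omega> boundary _ _ _ w]) (use \<phi> in auto)

text \<open>On each patch the integrals form a Gram matrix of fluctuations, and the patches are
  added with nonnegative weights.\<close>

lemma stab_mat_nonneg:
  assumes mesh: "fe_mesh \<Omega> \<T>" and patches: "partition_on \<T> \<P>" "\<forall>p\<in>\<P>. h p > 0"
    and \<phi>: "\<forall>i<n. cont_piecewise_poly \<Omega> \<T> (\<phi> i)"
    and w: "continuous_on (closure \<Omega>) w" and x: "x \<in> carrier_vec n"
  shows "x \<bullet>\<^sub>v (stab_mat \<epsilon> w \<P> h n \<phi> *\<^sub>v x) \<ge> 0"
proof -
  define I where "I p i j = (LINT x:\<Union>p|lebesgue. fluctuation w (\<Union>p) (\<phi> i) x \<bullet> fluctuation w (\<Union>p) (\<phi> j) x)"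
    for p i j
  have pcw: "piecewise_cont \<T> w"
    by (rule piecewise_cont_continuous_on) (use mesh w in \<open>simp add: fe_mesh_def\<close>)
  have pcf: "piecewise_cont \<T> (fluctuation w P (\<phi> i))" if "i < n" for i P
    unfolding fluctuation_def
    using \<phi> that by (intro piecewise_cont_diff_const piecewise_cont_inner pcw piecewise_cont_grad) auto
  have "(\<Sum>i<n. \<Sum>j<n. x $ i * x $ j * I p i j) \<ge> 0" if "p \<in> \<P>" for p
    unfolding I_def
  proof (rule gram_integral_nonneg)
    have "p \<subseteq> \<T>" using patches(1) that unfolding partition_on_def by blast
    then show "set_integrable lebesgue (\<Union>p) (\<lambda>x. fluctuation w (\<Union>p) (\<phi> i) x \<bullet> fluctuation w (\<Union>p) (\<phi> j) x)"
      if "i < n" "j < n" for i j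
      using that by (intro absolutely_integrable_on_piecewise_cont[OF mesh] piecewise_cont_inner pcf)
  qed
  then have "(\<Sum>p\<in>\<P>. stab_param \<epsilon> w (h p) (\<Union>p) * (\<Sum>i<n. \<Sum>j<n. x $ i * x $ j * I p i j)) \<ge> 0"
    using patches(2) by (intro sum_nonneg[of \<P>] mult_nonneg_nonneg[of "stab_param _ _ _ _"] stab_param_nonneg) auto
  \<comment> \<open>The sum over the patches is moved innermost, where it constitutes an entry of
    the stabilization matrix.\<close>
  also have "(\<Sum>p\<in>\<P>. stab_param \<epsilon> w (h p) (\<Union>p) * (\<Sum>i<n. \<Sum>j<n. x $ i * x $ j * I p i j)) =
      (\<Sum>p\<in>\<P>. \<Sum>i<n. \<Sum>j<n. x $ i * x $ j * (stab_param \<epsilon> w (h p) (\<Union>p) * I p i j))"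
    by (simp add: sum_distrib_left mult_ac)
  also have "\<dots> = (\<Sum>i<n. \<Sum>p\<in>\<P>. \<Sum>j<n. x $ i * x $ j * (stab_param \<epsilon> w (h p) (\<Union>p) * I p i j))"
    by (rule sum.swap)
  also have "\<dots> = (\<Sum>i<n. \<Sum>j<n. \<Sum>p\<in>\<P>. x $ i * x $ j * (stab_param \<epsilon> w (h p) (\<Union>p) * I p i j))"
    by (intro sum.cong refl sum.swap)
  also have "\<dots> = x \<bullet>\<^sub>v (stab_mat \<epsilon> w \<P> h n \<phi> *\<^sub>v x)"
    unfolding stab_mat_def quadratic_form_mat[OF x] prod.case by (simp add: I_def sum_distrib_left)
  finally show ?thesis .
qed

text \<open>The invertibility claims ensure that every \<open>mat_inv\<close> in the statement is a
  genuine inverse. Eigenvalues are taken over the complex numbers, so that their being real is part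
  of the conclusion. The heat equation is the case \<open>w = (\<lambda>x. 0)\<close>, where the
  wind conditions hold trivially for every splitting of the boundary and \<open>N\<close> and
  \<open>W\<close> vanish.\<close>

theorem theorem4p3:
  fixes \<Omega> \<Gamma>\<^sub>D \<Gamma>\<^sub>N :: "'a::euclidean_space set"
    and w :: "'a \<Rightarrow> 'a"
    and \<T> :: "'a set set"
    and \<P> :: "'a set set set" and h :: "'a set set \<Rightarrow> real"
    and n\<^sub>x n\<^sub>t :: nat
    and \<phi> :: "nat \<Rightarrow> 'a \<Rightarrow> real"
    and \<epsilon> \<beta> t\<^sub>f \<tau> :: real
    and M K N W L L\<^sub>p L\<^sub>m E A\<^sub>D C\<^sub>D T\<^sub>1 T\<^sub>2 \<Lambda>\<^sub>21 Mhat A B\<^sub>D S\<^sub>int St\<^sub>int :: "real mat"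
  assumes dim: "DIM('a) \<in> {1, 2, 3}"
    and domain: "bounded_lipschitz_domain \<Omega>"
    and boundary: "\<Gamma>\<^sub>D \<union> \<Gamma>\<^sub>N = frontier \<Omega>" "\<Gamma>\<^sub>D \<inter> \<Gamma>\<^sub>N = {}"
    and mesh: "fe_mesh \<Omega> \<T>"
    and patches: "partition_on \<T> \<P>" "\<forall>p\<in>\<P>. h p > 0"
    and basis: "\<forall>i<n\<^sub>x. cont_piecewise_poly \<Omega> \<T> (\<phi> i)"
      "\<forall>i<n\<^sub>x. \<forall>x\<in>\<Gamma>\<^sub>D. \<phi> i x = 0"
      "lin_indep_on \<Omega> n\<^sub>x \<phi>"
    and wind: "continuous_on (closure \<Omega>) w"
      "greens_formula \<Omega> \<T> w"
      "AE x in lebesgue. x \<in> \<Omega> \<longrightarrow> w differentiable (at x) \<and> divergence w x = 0"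
      "\<forall>x\<in>\<Gamma>\<^sub>N. w x \<bullet> outer_normal \<Omega> x = 0"
    and params: "\<epsilon> > 0" "\<beta> > 0" "t\<^sub>f > 0" "n\<^sub>t \<ge> 1" "\<tau> = t\<^sub>f / real n\<^sub>t"
    and fe_matrices:
      "M = mass_mat \<Omega> n\<^sub>x \<phi>"
      "K = stiffness_mat \<Omega> n\<^sub>x \<phi>"
      "N = convection_mat \<Omega> w n\<^sub>x \<phi>"
      "W = stab_mat \<epsilon> w \<P> h n\<^sub>x \<phi>"
      "L = \<epsilon> \<cdot>\<^sub>m K + N + W"
    and time_matrices:
      "L\<^sub>p = (\<tau> / 2) \<cdot>\<^sub>m L + M"
      "L\<^sub>m = (\<tau> / 2) \<cdot>\<^sub>m L - M"
      "E = subdiag_mat n\<^sub>t"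
      "A\<^sub>D = (\<tau> / 2) \<cdot>\<^sub>m (1\<^sub>m n\<^sub>t \<otimes>\<^sub>K M)"
      "C\<^sub>D = (\<tau> / (2 * \<beta>)) \<cdot>\<^sub>m (1\<^sub>m n\<^sub>t \<otimes>\<^sub>K M)"
      "T\<^sub>2 = (1\<^sub>m n\<^sub>t + E) \<otimes>\<^sub>K 1\<^sub>m n\<^sub>x"
      "T\<^sub>1 = transpose_mat T\<^sub>2"
      "\<Lambda>\<^sub>21 = 1\<^sub>m n\<^sub>t \<otimes>\<^sub>K L\<^sub>p + E \<otimes>\<^sub>K L\<^sub>m"
      "Mhat = (\<tau> / (2 * sqrt \<beta>)) \<cdot>\<^sub>m ((1\<^sub>m n\<^sub>t + E) \<otimes>\<^sub>K M)"
    and schur_complements: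
      "A = T\<^sub>1 * A\<^sub>D * transpose_mat T\<^sub>1"
      "B\<^sub>D = \<Lambda>\<^sub>21 * mat_inv T\<^sub>2"
      "S\<^sub>int = C\<^sub>D + B\<^sub>D * mat_inv A\<^sub>D * transpose_mat B\<^sub>D"
      "St\<^sub>int = (\<Lambda>\<^sub>21 + Mhat) * mat_inv A * transpose_mat (\<Lambda>\<^sub>21 + Mhat)"
  shows "invertible_mat T\<^sub>2 \<and> invertible_mat A\<^sub>D \<and> invertible_mat A \<and> invertible_mat St\<^sub>int \<and>
    (\<forall>\<mu>::complex. eigenvalue (map_mat complex_of_real (mat_inv St\<^sub>int * S\<^sub>int)) \<mu> \<longrightarrow>
       \<mu> \<in> complex_of_real ` {1/2..1})"
proof -
  define s where "s = \<tau> / 2"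
  have s: "s > 0" using params by (simp add: s_def)
  have \<Omega>: "open \<Omega>" using domain by (simp add: bounded_lipschitz_domain_def)
  have Kc: "K \<in> carrier_mat n\<^sub>x n\<^sub>x" and Nc: "N \<in> carrier_mat n\<^sub>x n\<^sub>x" and Wc: "W \<in> carrier_mat n\<^sub>x n\<^sub>x"
    and Mc: "M \<in> carrier_mat n\<^sub>x n\<^sub>x"
    by (auto simp: fe_matrices stiffness_mat_def convection_mat_def stab_mat_def mass_mat_def)
  have Lc: "L \<in> carrier_mat n\<^sub>x n\<^sub>x" using Kc Nc Wc by (simp add: fe_matrices(5))
  have Msym: "transpose_mat M = M"
    by (rule eq_matI) (auto simp: fe_matrices(1) mass_mat_def mult.commute)
  \<comment> \<open>Only the diffusive part \<open>\<epsilon> K\<close> and the stabilization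
    \<open>W\<close> contribute to the form, the skew part \<open>N\<close> dropping out.\<close>
  have Lnonneg: "x \<bullet>\<^sub>v (L *\<^sub>v x) \<ge> 0" if x: "x \<in> carrier_vec n\<^sub>x" for x
  proof -
    note c = mult_mat_vec_carrier[OF Kc x] mult_mat_vec_carrier[OF Nc x] mult_mat_vec_carrier[OF Wc x]
    have "L *\<^sub>v x = \<epsilon> \<cdot>\<^sub>v (K *\<^sub>v x) + N *\<^sub>v x + W *\<^sub>v x"
      unfolding fe_matrices(5) using Kc Nc Wc x
      by (simp add: add_mult_distrib_mat_vec[of _ n\<^sub>x n\<^sub>x] smult_mat_mult_vec[of _ n\<^sub>x n\<^sub>x])
    then have "x \<bullet>\<^sub>v (L *\<^sub>v x) = \<epsilon> * (x \<bullet>\<^sub>v (K *\<^sub>v x)) + x \<bullet>\<^sub>v (N *\<^sub>v x) + x \<bullet>\<^sub>v (W *\<^sub>v x)"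
      using x c by (simp add: scalar_prod_add_distrib[of _ n\<^sub>x])
    also have "x \<bullet>\<^sub>v (N *\<^sub>v x) = 0"
      unfolding fe_matrices by (rule convection_mat_skew[OF mesh \<Omega> boundary(1) basis(1,2) wind x])
    finally show ?thesis
      using stiffness_mat_nonneg[OF mesh \<Omega> basis(1) x] stab_mat_nonneg[OF mesh patches basis(1) wind(1) x]
        params(1) by (simp add: fe_matrices)
  qed
  have Mpos: "x \<bullet>\<^sub>v (M *\<^sub>v x) > 0" if "x \<in> carrier_vec n\<^sub>x" "x \<noteq> 0\<^sub>v n\<^sub>x" for x
    unfolding fe_matrices(1) by (rule mass_mat_pos_def[OF mesh \<Omega> basis(1,3) that])
  \<comment> \<open>With \<open>s = \<tau> / 2\<close> the time-stepping matrices take the form of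
    the all-at-once estimate; since \<open>T\<^sub>1\<close> is the transpose of
    \<open>T\<^sub>2\<close>, \<open>A\<close> becomes a congruence of \<open>A\<^sub>D\<close> by
    \<open>T\<^sub>2\<close>.\<close>
  have D: "A\<^sub>D = s \<cdot>\<^sub>m (1\<^sub>m n\<^sub>t \<otimes>\<^sub>K M)" and C: "C\<^sub>D = (s / \<beta>) \<cdot>\<^sub>m (1\<^sub>m n\<^sub>t \<otimes>\<^sub>K M)"
    and T: "T\<^sub>2 = (1\<^sub>m n\<^sub>t + subdiag_mat n\<^sub>t) \<otimes>\<^sub>K 1\<^sub>m n\<^sub>x"
    and \<Lambda>: "\<Lambda>\<^sub>21 = 1\<^sub>m n\<^sub>t \<otimes>\<^sub>K (s \<cdot>\<^sub>m L + M) + subdiag_mat n\<^sub>t \<otimes>\<^sub>K (s \<cdot>\<^sub>m L - M)"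
    and H: "Mhat = (s / sqrt \<beta>) \<cdot>\<^sub>m ((1\<^sub>m n\<^sub>t + subdiag_mat n\<^sub>t) \<otimes>\<^sub>K M)"
    and A: "A = transpose_mat T\<^sub>2 * A\<^sub>D * T\<^sub>2"
    by (simp_all add: time_matrices schur_complements(1) s_def mult.commute)
  note main = all_at_once_schur_complement[OF Lc Mc Msym Lnonneg Mpos s params(2) D C T \<Lambda> H A schur_complements(2-4)]
  show ?thesis using main by blast
qed

end
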